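(* Let $R$ be a commutative complete non-archimedean noetherian topological Hausdorff ring that has a countable fundamental system of neighbourhoods of $0$. Assume that there is a sequence of units of $R$ converging to $0$ and that the set of all topologically nilpotent elements of $R$ is a neighbourhood of $0$ (for example, these hypotheses on $R$ are satisfied if $R$ is a complete noetherian Hausdorff Tate ring). Let $M$ be a finitely generated $R$-module. Then there exists a unique $R$-module topology on $M$ such that $M$ is Hausdorff, complete and has a countable fundamental system of open neighbourhoods of $0$ (i.e. $M$ is metrisable and complete).
   Context: Rings have a $1$ and are commutative. An $R$-module topology on $M$ is a topology making $M$ a topological $R$-module. A Cauchy sequence in a topological group $G$ with neutral element $e$ is a sequence $(x_n)_{n\in\mathbb{N}}$ such that for every neighbourhood $V$ of $e$ there is an $N_0\in\mathbb{N}$ with $x_m\cdot x_k^{-1}\in V$ for all $m,k\geq N_0$. A topological group having a countable fundamental system of open neighbourhoods of its neutral element is called complete if every Cauchy sequence in it converges in it. A topological Hausdorff module (resp. ring) with a countable fundamental system of open neighbourhoods of $0$ is called complete if its additive group is complete. A topological ring $R$ is non-archimedean if it has a fundamental system of neighbourhoods of $0$ consisting of subgroups of $(R,+)$. An element $r\in R$ is topologically nilpotent if the sequence $(r^n)_{n\in\mathbb{N}}$ converges to $0$. A topological ring $R$ is called a Tate ring if it has a topologically nilpotent unit and there exist an open subring $R_0$ of $R$ and a finitely generated ideal $I$ of $R_0$ such that $(I^n)_{n\in\mathbb{N}}$ is a fundamental system of neighbourhoods of $0$ in $R_0$. *)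

theory Defs
  imports
    "HOL-Analysis.Analysis"
    "HOL-Algebra.Module"
    "HOL-Algebra.Subrings"
    "HOL-Algebra.Ideal_Product"
    "HOL-Algebra.Ring_Divisibility"
begin

text \<open>Topologies are objects of type \<open>'a topology\<close> on the carrier of a group, ring or module.
  Neighbourhoods need not be open.\<close>

definition neighbourhood :: "'a topology \<Rightarrow> 'a \<Rightarrow> 'a set \<Rightarrow> bool" where
  "neighbourhood T x V \<longleftrightarrow>
     V \<subseteq> topspace T \<and> (\<exists>U. openin T U \<and> x \<in> U \<and> U \<subseteq> V)"

definition fundamental_system :: "'a topology \<Rightarrow> 'a \<Rightarrow> 'a set set \<Rightarrow> bool" where
  "fundamental_system T x B \<longleftrightarrow>
     (\<forall>W\<in>B. neighbourhood T x W) \<and> (\<forall>V. neighbourhood T x V \<longrightarrow> (\<exists>W\<in>B. W \<subseteq> V))"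

definition topological_group :: "('a, 'm) monoid_scheme \<Rightarrow> 'a topology \<Rightarrow> bool" where
  "topological_group G T \<longleftrightarrow>
     group G \<and> topspace T = carrier G \<and>
     continuous_map (prod_topology T T) T (\<lambda>(x, y). x \<otimes>\<^bsub>G\<^esub> y) \<and>
     continuous_map T T (\<lambda>x. inv\<^bsub>G\<^esub> x)"

definition Cauchy_sequence ::
    "('a, 'm) monoid_scheme \<Rightarrow> 'a topology \<Rightarrow> (nat \<Rightarrow> 'a) \<Rightarrow> bool" where
  "Cauchy_sequence G T x \<longleftrightarrow>
     range x \<subseteq> carrier G \<and>
     (\<forall>V. neighbourhood T \<one>\<^bsub>G\<^esub> V \<longrightarrow>
        (\<exists>N. \<forall>m\<ge>N. \<forall>k\<ge>N. x m \<otimes>\<^bsub>G\<^esub> inv\<^bsub>G\<^esub> (x k) \<in> V))"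

text \<open>Completeness is sequential; it is used only for groups whose neutral element has a countable
  fundamental system of neighbourhoods. For rings and modules it is applied to \<open>add_monoid\<close>.\<close>

definition complete_group :: "('a, 'm) monoid_scheme \<Rightarrow> 'a topology \<Rightarrow> bool" where
  "complete_group G T \<longleftrightarrow>
     (\<forall>x. Cauchy_sequence G T x \<longrightarrow> (\<exists>l. limitin T x l sequentially))"

definition topological_ring :: "('a, 'm) ring_scheme \<Rightarrow> 'a topology \<Rightarrow> bool" where
  "topological_ring R T \<longleftrightarrow>
     cring R \<and> topological_group (add_monoid R) T \<and>
     continuous_map (prod_topology T T) T (\<lambda>(x, y). x \<otimes>\<^bsub>R\<^esub> y)"

definition topological_module ::
    "('a, 'm) ring_scheme \<Rightarrow> 'a topology \<Rightarrow> ('a, 'b, 'n) module_scheme \<Rightarrow> 'b topology \<Rightarrow> bool" where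
  "topological_module R T M S \<longleftrightarrow>
     module R M \<and> topological_ring R T \<and> topological_group (add_monoid M) S \<and>
     continuous_map (prod_topology T S) S (\<lambda>(r, x). r \<odot>\<^bsub>M\<^esub> x)"

definition finitely_generated_module ::
    "('a, 'm) ring_scheme \<Rightarrow> ('a, 'b, 'n) module_scheme \<Rightarrow> bool" where
  "finitely_generated_module R M \<longleftrightarrow>
     module R M \<and>
     (\<exists>A. finite A \<and> A \<subseteq> carrier M \<and>
        (\<forall>x\<in>carrier M. \<exists>c\<in>A \<rightarrow> carrier R. x = (\<Oplus>\<^bsub>M\<^esub>a\<in>A. c a \<odot>\<^bsub>M\<^esub> a)))"

definition non_archimedean :: "('a, 'm) ring_scheme \<Rightarrow> 'a topology \<Rightarrow> bool" where
  "non_archimedean R T \<longleftrightarrow>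
     (\<exists>B. fundamental_system T \<zero>\<^bsub>R\<^esub> B \<and> (\<forall>W\<in>B. subgroup W (add_monoid R)))"

definition topologically_nilpotent :: "('a, 'm) ring_scheme \<Rightarrow> 'a topology \<Rightarrow> 'a \<Rightarrow> bool" where
  "topologically_nilpotent R T r \<longleftrightarrow>
     r \<in> carrier R \<and> limitin T (\<lambda>n::nat. r [^]\<^bsub>R\<^esub> n) \<zero>\<^bsub>R\<^esub> sequentially"

primrec ideal_power :: "('a, 'm) ring_scheme \<Rightarrow> 'a set \<Rightarrow> nat \<Rightarrow> 'a set" where
  "ideal_power R I 0 = carrier R"
| "ideal_power R I (Suc n) = ideal_prod R (ideal_power R I n) I"

text \<open>The ideal \<open>I\<close> and its powers are formed in the subring \<open>R\<^sub>0\<close>, not in \<open>R\<close>,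
  where \<open>I\<close> is in general not an ideal.\<close>

definition Tate_ring :: "('a, 'm) ring_scheme \<Rightarrow> 'a topology \<Rightarrow> bool" where
  "Tate_ring R T \<longleftrightarrow>
     topological_ring R T \<and>
     (\<exists>u\<in>Units R. topologically_nilpotent R T u) \<and>
     (\<exists>R\<^sub>0 I A. subring R\<^sub>0 R \<and> openin T R\<^sub>0 \<and>
        finite A \<and> A \<subseteq> R\<^sub>0 \<and> I = Idl\<^bsub>R\<lparr>carrier := R\<^sub>0\<rparr>\<^esub> A \<and>
        fundamental_system (subtopology T R\<^sub>0) \<zero>\<^bsub>R\<^esub>
          (range (ideal_power (R\<lparr>carrier := R\<^sub>0\<rparr>) I)))"

definition zero_sequence_ring :: "('a, 'm) ring_scheme \<Rightarrow> 'a topology \<Rightarrow> bool" where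
  "zero_sequence_ring R T \<longleftrightarrow>
     topological_ring R T \<and>
     noetherian_ring R \<and>
     Hausdorff_space T \<and>
     (\<exists>B. countable B \<and> fundamental_system T \<zero>\<^bsub>R\<^esub> B) \<and>
     complete_group (add_monoid R) T \<and>
     non_archimedean R T \<and>
     (\<exists>u. (\<forall>n. u n \<in> Units R) \<and> limitin T u \<zero>\<^bsub>R\<^esub> sequentially) \<and>
     neighbourhood T \<zero>\<^bsub>R\<^esub> {r \<in> carrier R. topologically_nilpotent R T r}"

end

theory Submission
  imports Defs
begin

text \<open>
  Let \<open>V n\<close> be a decreasing base of neighbourhoods of zero in \<open>R\<close> that consists of additive
  subgroups, and let \<open>E\<close> be a finite set of generators of \<open>M\<close>. The topology in question is the
  quotient topology of \<open>R^E\<close>: its neighbourhoods of zero are generated by the sets \<open>W n\<close> of linear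
  combinations of \<open>E\<close> with coefficients in \<open>V n\<close>. That this is a module topology follows from the
  continuity of the multiplication of \<open>R\<close>, and it is complete because the differences of
  a rapidly convergent subsequence can be lifted to coefficients, whose sums converge in \<open>R\<close>
  (\<open>W_topological_module\<close>, \<open>W_complete\<close>). Two things remain.

  Uniqueness is an open mapping theorem, \<open>lincombs_nb\<close>. Let \<open>S\<close> be a complete Hausdorff module
  topology on \<open>M\<close> with a countable base at zero, and let \<open>u k\<close> be units of \<open>R\<close> that converge to
  zero. Each neighbourhood of zero contains some \<open>W n\<close> since scalar multiplication is continuous.
  Conversely, every \<open>x\<close> has a multiple \<open>u k x\<close> in \<open>W n\<close>, so \<open>M\<close> is the union of the closed sets
  \<open>{x. u k x \<in> closure (W n)}\<close>. By Baire's theorem one of them has an interior point, and since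
  \<open>W n\<close> is a subgroup and \<open>u k\<close> acts as a homeomorphism, the closure of \<open>W n\<close> is a neighbourhood of
  zero. Successive approximation, with coefficients that converge because \<open>R\<close> is complete, shows
  that \<open>W n\<close> is closed. Hence \<open>S\<close> has the same neighbourhoods of zero as the quotient topology
  (\<open>eq_W_topology\<close>).

  The quotient topology is Hausdorff because every submodule \<open>K\<close> of \<open>R^E\<close> is closed
  (\<open>function_submodule_closed\<close>). The closure \<open>N\<close> of \<open>K\<close> is a complete Hausdorff module all of whose
  submodules are finitely generated, since \<open>R\<close> is noetherian. Suppose that \<open>N = L + R e\<close> for
  a submodule \<open>L\<close> that contains \<open>K\<close>. Then \<open>L\<close> is dense and is generated by a finite set \<open>F\<close>. The open
  mapping theorem for the generators \<open>F \<union> {e}\<close> of \<open>N\<close> yields \<open>e = l + f + c e\<close> with \<open>l\<close> in \<open>L\<close>, with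
  \<open>f\<close> a combination of \<open>F\<close>, and with \<open>c\<close> topologically nilpotent. So \<open>(1 - c) e\<close> is in \<open>L\<close>, and
  \<open>1 - c\<close> is a unit by the geometric series; hence \<open>e\<close> is in \<open>L\<close> (\<open>adjoin_element\<close>). Removing the
  generators of \<open>N\<close> one at a time in this way gives \<open>N = K\<close> (\<open>dense_submodule_eq\<close>).

  For a Tate ring, the powers of the ideal \<open>I\<close> of the open subring form a countable base of
  subgroups, the elements of \<open>I\<close> are topologically nilpotent, and the powers of the topologically
  nilpotent unit are units that converge to zero.
\<close>

section \<open>Topological abelian groups through neighbourhoods of zero\<close>

lemma continuous_map_prodI:
  assumes "\<And>x y. x \<in> topspace X \<Longrightarrow> y \<in> topspace Y \<Longrightarrow> f (x, y) \<in> topspace Z"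
    and "\<And>x y U. \<lbrakk>x \<in> topspace X; y \<in> topspace Y; openin Z U; f (x, y) \<in> U\<rbrakk> \<Longrightarrow>
      \<exists>A B. openin X A \<and> openin Y B \<and> x \<in> A \<and> y \<in> B \<and> (\<forall>a\<in>A. \<forall>b\<in>B. f (a, b) \<in> U)"
  shows "continuous_map (prod_topology X Y) Z f"
  unfolding continuous_map_def
proof (intro conjI allI impI)
  show "f \<in> topspace (prod_topology X Y) \<rightarrow> topspace Z"
    using assms(1) by auto
  fix U assume U: "openin Z U"
  show "openin (prod_topology X Y) {p \<in> topspace (prod_topology X Y). f p \<in> U}"
    unfolding openin_prod_topology_alt
  proof (intro allI impI)
    fix x y assume "(x, y) \<in> {p \<in> topspace (prod_topology X Y). f p \<in> U}"
    then obtain A B where "openin X A" "openin Y B" "x \<in> A" "y \<in> B" "\<forall>a\<in>A. \<forall>b\<in>B. f (a, b) \<in> U"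
      using assms(2)[of x y U] U by auto
    then show "\<exists>A B. openin X A \<and> openin Y B \<and> x \<in> A \<and> y \<in> B \<and>
        A \<times> B \<subseteq> {p \<in> topspace (prod_topology X Y). f p \<in> U}"
      by (intro exI[of _ A] exI[of _ B]) (auto dest: openin_subset)
  qed
qed

lemma continuous_map_prodD:
  assumes "continuous_map (prod_topology X Y) Z f" "x \<in> topspace X" "y \<in> topspace Y"
    "openin Z U" "f (x, y) \<in> U"
  shows "\<exists>A B. openin X A \<and> openin Y B \<and> x \<in> A \<and> y \<in> B \<and> (\<forall>a\<in>A. \<forall>b\<in>B. f (a, b) \<in> U)"
proof -
  let ?P = "{p \<in> topspace (prod_topology X Y). f p \<in> U}"
  have "openin (prod_topology X Y) ?P"
    by (rule openin_continuous_map_preimage[OF assms(1,4)])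
  moreover have "(x, y) \<in> ?P" using assms(2,3,5) by simp
  ultimately have "\<exists>A B. openin X A \<and> openin Y B \<and> x \<in> A \<and> y \<in> B \<and> A \<times> B \<subseteq> ?P"
    using iffD1[OF openin_prod_topology_alt, of X Y ?P] by meson
  then show ?thesis by fast
qed

lemma neighbourhood_Int:
  assumes "neighbourhood T x V" "neighbourhood T x W"
  shows "neighbourhood T x (V \<inter> W)"
proof -
  obtain A B where "openin T A" "x \<in> A" "A \<subseteq> V" "openin T B" "x \<in> B" "B \<subseteq> W"
    using assms unfolding neighbourhood_def by blast
  then show ?thesis
    using assms unfolding neighbourhood_def by (intro conjI exI[of _ "A \<inter> B"]) auto
qed

lemma neighbourhood_mono:
  "neighbourhood T x V \<Longrightarrow> V \<subseteq> W \<Longrightarrow> W \<subseteq> topspace T \<Longrightarrow> neighbourhood T x W"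
  unfolding neighbourhood_def by blast

lemma openin_imp_neighbourhood: "openin T U \<Longrightarrow> x \<in> U \<Longrightarrow> neighbourhood T x U"
  unfolding neighbourhood_def by (auto dest: openin_subset)

lemma neighbourhood_self: "neighbourhood T x V \<Longrightarrow> x \<in> V"
  unfolding neighbourhood_def by blast

context abelian_group
begin

lemma uminus_zero: "\<ominus> \<zero> = \<zero>"
  using add.inv_one by (simp add: a_inv_def)

text \<open>The simplifier rules of commutative groups sort sums but do not cancel a summand against its
  inverse when other summands stand between them. The following rules cancel across one or two
  summands, which is enough for \<open>group_simps\<close> to prove telescoping identities.\<close>

lemma add_cancel_2:
  assumes "x \<in> carrier G" "y \<in> carrier G"
  shows "x \<oplus> (y \<oplus> \<ominus> x) = y" "\<ominus> x \<oplus> (y \<oplus> x) = y"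
  using assms by (simp_all add: a_lcomm[of _ y] r_neg l_neg)

lemma add_cancel_2':
  assumes "x \<in> carrier G" "y \<in> carrier G" "z \<in> carrier G"
  shows "x \<oplus> (y \<oplus> (\<ominus> x \<oplus> z)) = y \<oplus> z" "\<ominus> x \<oplus> (y \<oplus> (x \<oplus> z)) = y \<oplus> z"
  using assms by (simp_all add: a_lcomm[of _ y] r_neg1 r_neg2)

lemma add_cancel_3:
  assumes "x \<in> carrier G" "y \<in> carrier G" "w \<in> carrier G"
  shows "x \<oplus> (y \<oplus> (w \<oplus> \<ominus> x)) = y \<oplus> w" "\<ominus> x \<oplus> (y \<oplus> (w \<oplus> x)) = y \<oplus> w"
  using assms by (simp_all add: a_lcomm[of _ y] add_cancel_2)

lemma add_cancel_3':
  assumes "x \<in> carrier G" "y \<in> carrier G" "z \<in> carrier G" "w \<in> carrier G"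
  shows "x \<oplus> (y \<oplus> (w \<oplus> (\<ominus> x \<oplus> z))) = y \<oplus> (w \<oplus> z)"
    "\<ominus> x \<oplus> (y \<oplus> (w \<oplus> (x \<oplus> z))) = y \<oplus> (w \<oplus> z)"
  using assms by (simp_all add: a_lcomm[of _ y] add_cancel_2')

lemmas group_simps = uminus_zero minus_eq minus_add minus_minus a_ac l_neg r_neg r_neg1 r_neg2
  add_cancel_2 add_cancel_2' add_cancel_3 add_cancel_3'

lemma eq_of_diff_eq_zero:
  assumes "x \<in> carrier G" "y \<in> carrier G" "x \<ominus> y = \<zero>"
  shows "x = y"
proof -
  have "x = (x \<ominus> y) \<oplus> y" using assms(1,2) by (simp add: group_simps)
  then show ?thesis using assms by simp
qed

end

locale topological_abelian_group = abelian_group G for G (structure) +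
  fixes T
  assumes topological_group: "topological_group (add_monoid G) T"
begin

abbreviation nb :: "'a set \<Rightarrow> bool" where "nb \<equiv> neighbourhood T \<zero>"

lemma topspace_eq [simp]: "topspace T = carrier G"
  using topological_group unfolding topological_group_def by simp

lemma nb_subset: "nb W \<Longrightarrow> W \<subseteq> carrier G"
  unfolding neighbourhood_def by simp

lemma add_continuous: "continuous_map (prod_topology T T) T (\<lambda>(x, y). x \<oplus> y)"
  using topological_group unfolding topological_group_def by simp

lemma uminus_continuous: "continuous_map T T (\<lambda>x. \<ominus> x)"
  using topological_group unfolding topological_group_def a_inv_def by simp

lemma translate_open:
  assumes "x \<in> carrier G" "openin T U"
  shows "openin T {y \<in> carrier G. x \<oplus> y \<in> U}"
proof -
  have "continuous_map T (prod_topology T T) (\<lambda>y. (x, y))"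
    using assms by (auto simp: continuous_map_paired)
  from continuous_map_compose[OF this add_continuous]
  have "continuous_map T T (\<lambda>y. x \<oplus> y)" by (simp add: comp_def)
  from openin_continuous_map_preimage[OF this assms(2)] show ?thesis by simp
qed

text \<open>Translations are homeomorphisms, so a group topology is determined by its neighbourhoods of
  zero. Openness, limits and closures are therefore expressed by them alone.\<close>

lemma openin_iff_nb:
  "openin T U \<longleftrightarrow> U \<subseteq> carrier G \<and> (\<forall>x\<in>U. \<exists>W. nb W \<and> (\<forall>w\<in>W. x \<oplus> w \<in> U))"
proof (intro iffI conjI ballI)
  assume U: "openin T U"
  then show sub: "U \<subseteq> carrier G" using openin_subset by fastforce
  fix x assume "x \<in> U"
  with sub have x: "x \<in> carrier G" by auto
  let ?W = "{y \<in> carrier G. x \<oplus> y \<in> U}"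
  have "nb ?W"
    using translate_open[OF x U] x \<open>x \<in> U\<close> by (intro openin_imp_neighbourhood) auto
  then show "\<exists>W. nb W \<and> (\<forall>w\<in>W. x \<oplus> w \<in> U)" by blast
next
  assume U: "U \<subseteq> carrier G \<and> (\<forall>x\<in>U. \<exists>W. nb W \<and> (\<forall>w\<in>W. x \<oplus> w \<in> U))"
  show "openin T U"
  proof (subst openin_subopen, intro ballI)
    fix x assume "x \<in> U"
    with U obtain W where x: "x \<in> carrier G" and W: "nb W" "\<And>w. w \<in> W \<Longrightarrow> x \<oplus> w \<in> U" by blast
    then obtain A where A: "openin T A" "\<zero> \<in> A" "A \<subseteq> W" unfolding neighbourhood_def by blast
    let ?B = "{y \<in> carrier G. \<ominus> x \<oplus> y \<in> A}"
    have "openin T ?B" using translate_open[of "\<ominus> x" A] x A by auto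
    moreover have "x \<in> ?B" using x A by (simp add: l_neg)
    moreover have "?B \<subseteq> U"
    proof
      fix y assume y: "y \<in> ?B"
      then have "x \<oplus> (\<ominus> x \<oplus> y) \<in> U" using W A by blast
      then show "y \<in> U" using x y by (simp add: r_neg2)
    qed
    ultimately show "\<exists>B. openin T B \<and> x \<in> B \<and> B \<subseteq> U" by blast
  qed
qed

lemma openin_nbD: "openin T U \<Longrightarrow> x \<in> U \<Longrightarrow> \<exists>W. nb W \<and> (\<forall>w\<in>W. x \<oplus> w \<in> U)"
  using openin_iff_nb[of U] by simp

lemma limitin_iff_nb:
  "limitin T f l sequentially \<longleftrightarrow>
     l \<in> carrier G \<and> (\<forall>W. nb W \<longrightarrow> (\<exists>N. \<forall>n\<ge>N. f n \<in> carrier G \<and> f n \<ominus> l \<in> W))"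
proof
  assume lim: "limitin T f l sequentially"
  then have l: "l \<in> carrier G" unfolding limitin_def by simp
  show "l \<in> carrier G \<and> (\<forall>W. nb W \<longrightarrow> (\<exists>N. \<forall>n\<ge>N. f n \<in> carrier G \<and> f n \<ominus> l \<in> W))"
  proof (intro conjI allI impI l)
    fix W assume "nb W"
    then obtain A where A: "openin T A" "\<zero> \<in> A" "A \<subseteq> W" unfolding neighbourhood_def by blast
    let ?B = "{y \<in> carrier G. \<ominus> l \<oplus> y \<in> A}"
    have "openin T ?B" using translate_open[of "\<ominus> l" A] l A by auto
    moreover have "l \<in> ?B" using l A by (simp add: l_neg)
    ultimately obtain N where "\<forall>n\<ge>N. f n \<in> ?B"
      using lim unfolding limitin_sequentially by blast
    then show "\<exists>N. \<forall>n\<ge>N. f n \<in> carrier G \<and> f n \<ominus> l \<in> W"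
      using A l by (intro exI[of _ N]) (auto simp: minus_eq a_comm)
  qed
next
  assume R: "l \<in> carrier G \<and> (\<forall>W. nb W \<longrightarrow> (\<exists>N. \<forall>n\<ge>N. f n \<in> carrier G \<and> f n \<ominus> l \<in> W))"
  show "limitin T f l sequentially"
    unfolding limitin_sequentially
  proof (intro conjI allI impI)
    show "l \<in> topspace T" using R by simp
    fix U assume "openin T U \<and> l \<in> U"
    then obtain W where W: "nb W" "\<And>w. w \<in> W \<Longrightarrow> l \<oplus> w \<in> U" using openin_iff_nb[of U] by blast
    from W R obtain N where N: "\<And>n. n \<ge> N \<Longrightarrow> f n \<in> carrier G \<and> f n \<ominus> l \<in> W" by blast
    have "f n \<in> U" if "n \<ge> N" for n
    proof -
      have "l \<oplus> (f n \<ominus> l) \<in> U" using W N that by blast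
      moreover have "l \<oplus> (f n \<ominus> l) = f n" using N[OF that] conjunct1[OF R] by (simp add: group_simps)
      ultimately show ?thesis by simp
    qed
    then show "\<exists>N. \<forall>n\<ge>N. f n \<in> U" by blast
  qed
qed

lemma nb_halving:
  assumes "nb W"
  shows "\<exists>W'. nb W' \<and> W' \<subseteq> W \<and> (\<forall>x\<in>W'. \<forall>y\<in>W'. x \<oplus> y \<in> W \<and> x \<ominus> y \<in> W)"
proof -
  obtain C where C: "openin T C" "\<zero> \<in> C" "C \<subseteq> W" using assms unfolding neighbourhood_def by blast
  have "\<exists>A B. openin T A \<and> openin T B \<and> \<zero> \<in> A \<and> \<zero> \<in> B \<and> (\<forall>a\<in>A. \<forall>b\<in>B. a \<oplus> b \<in> C)"
    using continuous_map_prodD[OF add_continuous, of \<zero> \<zero> C] C(1,2) by simp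
  then obtain A B where AB: "openin T A" "openin T B" "\<zero> \<in> A" "\<zero> \<in> B"
      "\<And>a b. a \<in> A \<Longrightarrow> b \<in> B \<Longrightarrow> a \<oplus> b \<in> C"
    by blast
  let ?D = "{y \<in> carrier G. \<ominus> y \<in> B}"
  have D: "openin T ?D"
    using openin_continuous_map_preimage[OF uminus_continuous AB(2)] by simp
  have nb: "nb (A \<inter> B \<inter> ?D \<inter> W)"
    using neighbourhood_Int[OF neighbourhood_Int[OF neighbourhood_Int[OF openin_imp_neighbourhood[OF AB(1,3)]
      openin_imp_neighbourhood[OF AB(2,4)]] openin_imp_neighbourhood[OF D]] assms] AB(4) uminus_zero by simp
  show ?thesis
  proof (intro exI[of _ "A \<inter> B \<inter> ?D \<inter> W"] conjI ballI nb)
    show "A \<inter> B \<inter> ?D \<inter> W \<subseteq> W" by blast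
    fix x y assume "x \<in> A \<inter> B \<inter> ?D \<inter> W" "y \<in> A \<inter> B \<inter> ?D \<inter> W"
    then have "x \<in> A" "y \<in> B" "\<ominus> y \<in> B" by auto
    then have "x \<oplus> y \<in> C" "x \<oplus> \<ominus> y \<in> C" by (simp_all only: AB(5))
    then show "x \<oplus> y \<in> W" "x \<ominus> y \<in> W"
      unfolding minus_eq by (simp_all only: subsetD[OF C(3)])
  qed
qed

lemma in_closure_iff_nb:
  assumes "A \<subseteq> carrier G"
  shows "x \<in> T closure_of A \<longleftrightarrow> x \<in> carrier G \<and> (\<forall>W. nb W \<longrightarrow> (\<exists>a\<in>A. x \<ominus> a \<in> W))"
proof
  assume x: "x \<in> T closure_of A"
  then have xG: "x \<in> carrier G" by (auto simp: closure_of_def)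
  have near: "\<exists>a\<in>A. x \<ominus> a \<in> W" if W: "nb W" for W
  proof -
    obtain W' where W': "nb W'" "W' \<subseteq> W" "\<forall>x\<in>W'. \<forall>y\<in>W'. x \<oplus> y \<in> W \<and> x \<ominus> y \<in> W"
      using nb_halving[OF W] by blast
    then obtain C where C: "openin T C" "\<zero> \<in> C" "C \<subseteq> W'" unfolding neighbourhood_def by blast
    let ?B = "{y \<in> carrier G. \<ominus> x \<oplus> y \<in> C}"
    have "openin T ?B" using translate_open[of "\<ominus> x" C] xG C by auto
    moreover have "x \<in> ?B" using xG C by (simp add: l_neg)
    ultimately have "\<exists>a. a \<in> A \<and> a \<in> ?B"
      using iffD1[OF in_closure_of x] by meson
    then obtain a where a: "a \<in> A" "a \<in> carrier G" "\<ominus> x \<oplus> a \<in> C" by blast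
    then have "\<zero> \<ominus> (\<ominus> x \<oplus> a) \<in> W" using W'(3) C by blast
    moreover have "\<zero> \<ominus> (\<ominus> x \<oplus> a) = x \<ominus> a" using a xG by (simp add: group_simps)
    ultimately show ?thesis using a by auto
  qed
  show "x \<in> carrier G \<and> (\<forall>W. nb W \<longrightarrow> (\<exists>a\<in>A. x \<ominus> a \<in> W))"
    using xG near by simp
next
  assume R: "x \<in> carrier G \<and> (\<forall>W. nb W \<longrightarrow> (\<exists>a\<in>A. x \<ominus> a \<in> W))"
  have "\<exists>y\<in>A. y \<in> U" if xU: "x \<in> U" "openin T U" for U
  proof -
    obtain W where W: "nb W" "\<And>w. w \<in> W \<Longrightarrow> x \<oplus> w \<in> U" using openin_nbD[OF xU(2,1)] by meson
    obtain W' where W': "nb W'" "W' \<subseteq> W" "\<forall>x\<in>W'. \<forall>y\<in>W'. x \<oplus> y \<in> W \<and> x \<ominus> y \<in> W"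
      using nb_halving[OF W(1)] by blast
    obtain a where a: "a \<in> A" "x \<ominus> a \<in> W'" using conjunct2[OF R] W'(1) by meson
    then have "\<zero> \<ominus> (x \<ominus> a) \<in> W" using W'(3) neighbourhood_self[OF W'(1)] by simp
    then have "x \<oplus> (\<zero> \<ominus> (x \<ominus> a)) \<in> U" by (rule W(2))
    moreover have "x \<oplus> (\<zero> \<ominus> (x \<ominus> a)) = a" using conjunct1[OF R] subsetD[OF assms a(1)] by (simp add: group_simps)
    ultimately show ?thesis using a by auto
  qed
  then show "x \<in> T closure_of A" using conjunct1[OF R] unfolding in_closure_of by auto
qed

end

text \<open>The form in which uniqueness of the module topology is proved.\<close>

lemma topological_group_eqI:
  assumes "topological_abelian_group G S" "topological_abelian_group G T"
    and "\<And>W. neighbourhood S \<zero>\<^bsub>G\<^esub> W \<longleftrightarrow> neighbourhood T \<zero>\<^bsub>G\<^esub> W"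
  shows "S = T"
  unfolding topology_eq
  using topological_abelian_group.openin_iff_nb[OF assms(1)]
    topological_abelian_group.openin_iff_nb[OF assms(2)] assms(3) by simp

section \<open>A Baire theorem for complete groups\<close>

context topological_abelian_group begin

lemma complete_group_iff_nb:
  "complete_group (add_monoid G) T \<longleftrightarrow>
     (\<forall>x. range x \<subseteq> carrier G \<and> (\<forall>W. nb W \<longrightarrow> (\<exists>N. \<forall>m\<ge>N. \<forall>k\<ge>N. x m \<ominus> x k \<in> W))
        \<longrightarrow> (\<exists>l. limitin T x l sequentially))"
  by (simp add: complete_group_def Cauchy_sequence_def a_minus_def a_inv_def)

end

locale complete_metrizable_group = topological_abelian_group +
  assumes complete: "complete_group (add_monoid G) T"
    and countable_base: "\<exists>B. countable B \<and> fundamental_system T \<zero> B"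
begin

text \<open>A substitute for a metric: \<open>U n\<close> plays the role of the ball of radius \<open>2^-n\<close> about zero.\<close>

definition halving_base :: "(nat \<Rightarrow> 'a set) \<Rightarrow> bool" where
  "halving_base U \<longleftrightarrow> (\<forall>n. nb (U n)) \<and> (\<forall>n. U (Suc n) \<subseteq> U n) \<and>
     (\<forall>n. \<forall>x\<in>U (Suc n). \<forall>y\<in>U (Suc n). x \<oplus> y \<in> U n \<and> x \<ominus> y \<in> U n) \<and>
     (\<forall>W. nb W \<longrightarrow> (\<exists>n. U n \<subseteq> W))"

lemma halving_baseD:
  assumes "halving_base U"
  shows "nb (U n)" "U (Suc n) \<subseteq> U n"
    "x \<in> U (Suc n) \<Longrightarrow> y \<in> U (Suc n) \<Longrightarrow> x \<oplus> y \<in> U n"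
    "x \<in> U (Suc n) \<Longrightarrow> y \<in> U (Suc n) \<Longrightarrow> x \<ominus> y \<in> U n"
    "nb W \<Longrightarrow> \<exists>n. U n \<subseteq> W"
    "m \<le> n \<Longrightarrow> U n \<subseteq> U m"
  using assms lift_Suc_antimono_le[of U m n] unfolding halving_base_def by simp_all

lemma halving_base_exists: "\<exists>U. halving_base U"
proof -
  obtain B where B: "countable B" "\<And>W. W \<in> B \<Longrightarrow> nb W" "\<And>V. nb V \<Longrightarrow> \<exists>W\<in>B. W \<subseteq> V"
    using countable_base unfolding fundamental_system_def by auto
  have "nb (carrier G)"
    using openin_imp_neighbourhood[OF openin_topspace, of \<zero> T] by simp
  then have ne: "B \<noteq> {}" using B(3) by blast
  let ?b = "from_nat_into B"
  have b: "nb (?b n)" for n using B(2) from_nat_into[OF ne] by simp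
  have "\<exists>U. \<forall>n. (nb (U n) \<and> U n \<subseteq> ?b n) \<and>
      (U (Suc n) \<subseteq> U n \<and> (\<forall>x\<in>U (Suc n). \<forall>y\<in>U (Suc n). x \<oplus> y \<in> U n \<and> x \<ominus> y \<in> U n))"
  proof (rule dependent_nat_choice[where P = "\<lambda>n W. nb W \<and> W \<subseteq> ?b n"
        and Q = "\<lambda>n W W'. W' \<subseteq> W \<and> (\<forall>x\<in>W'. \<forall>y\<in>W'. x \<oplus> y \<in> W \<and> x \<ominus> y \<in> W)"])
    show "\<exists>W. nb W \<and> W \<subseteq> ?b 0" using b by blast
    fix W n assume "nb W \<and> W \<subseteq> ?b n"
    then obtain W' where W': "nb W'" "W' \<subseteq> W" "\<forall>x\<in>W'. \<forall>y\<in>W'. x \<oplus> y \<in> W \<and> x \<ominus> y \<in> W"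
      using nb_halving[of W] by meson
    have "nb (W' \<inter> ?b (Suc n))" using neighbourhood_Int[OF W'(1) b] .
    then show "\<exists>W'. (nb W' \<and> W' \<subseteq> ?b (Suc n)) \<and> W' \<subseteq> W \<and>
        (\<forall>x\<in>W'. \<forall>y\<in>W'. x \<oplus> y \<in> W \<and> x \<ominus> y \<in> W)"
      using W' by (intro exI[of _ "W' \<inter> ?b (Suc n)"] conjI) auto
  qed
  then obtain U where U: "\<And>n. nb (U n)" "\<And>n. U n \<subseteq> ?b n" "\<And>n. U (Suc n) \<subseteq> U n"
      "\<And>n. \<forall>x\<in>U (Suc n). \<forall>y\<in>U (Suc n). x \<oplus> y \<in> U n \<and> x \<ominus> y \<in> U n"
    by meson
  have base: "\<exists>n. U n \<subseteq> W" if nbW: "nb W" for W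
  proof -
    obtain W' where W': "W' \<in> B" "W' \<subseteq> W" using B(3)[OF nbW] by meson
    then obtain n where "?b n = W'" using from_nat_into_surj[OF B(1)] by meson
    then show ?thesis using U(2)[of n] W' by blast
  qed
  show ?thesis unfolding halving_base_def
  proof (rule exI[of _ U], intro conjI)
    show "\<forall>n. nb (U n)" "\<forall>n. U (Suc n) \<subseteq> U n"
      "\<forall>n. \<forall>x\<in>U (Suc n). \<forall>y\<in>U (Suc n). x \<oplus> y \<in> U n \<and> x \<ominus> y \<in> U n"
      by (rule allI, rule U)+
    show "\<forall>W. nb W \<longrightarrow> (\<exists>n. U n \<subseteq> W)" using base by simp
  qed
qed

text \<open>If no \<open>F n\<close> has an interior point, one can choose points \<open>x k\<close> and radii \<open>j k\<close> such that a ball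
  about \<open>x (Suc k)\<close> avoids the closed set \<open>F k\<close> and the steps shrink fast enough for \<open>x\<close> to be
  a Cauchy sequence. Its limit lies in all these balls, hence in no \<open>F k\<close>.\<close>

lemma baire:
  assumes closed: "\<And>n. closedin T (F n)" and cover: "carrier G \<subseteq> (\<Union>n::nat. F n)"
  shows "\<exists>n x W. x \<in> carrier G \<and> nb W \<and> (\<forall>w\<in>W. x \<oplus> w \<in> F n)"
proof (rule ccontr)
  assume neg: "\<not> ?thesis"
  obtain U where "halving_base U" using halving_base_exists ..
  note U = halving_baseD[OF this]
  have UG: "u \<in> carrier G" if "u \<in> U n" for u n
    using that nb_subset[OF U(1)] by auto
  \<comment> \<open>The avoided ball has index \<open>j' - 1\<close>: the limit is only known to be within two \<open>U j'\<close>-steps of \<open>x'\<close>.\<close>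
  have step: "\<exists>x' j'. x' \<in> carrier G \<and> j < j' \<and> x' \<ominus> x \<in> U (Suc j) \<and> (\<forall>w\<in>U (j' - 1). x' \<oplus> w \<notin> F k)"
    if x: "x \<in> carrier G" for x j k
  proof -
    obtain w where w: "w \<in> U (Suc j)" "x \<oplus> w \<notin> F k" using neg x U(1) by meson
    have wG: "w \<in> carrier G" using UG w(1) .
    have "openin T (carrier G - F k)" using closed[of k] by (simp add: closedin_def)
    moreover have "x \<oplus> w \<in> carrier G - F k" using w x wG by simp
    ultimately obtain W where W: "nb W" "\<forall>v\<in>W. x \<oplus> w \<oplus> v \<in> carrier G - F k"
      using openin_nbD by meson
    obtain i where i: "U i \<subseteq> W" using U(5)[OF W(1)] by meson
    have "U (max (Suc i) (Suc j) - 1) \<subseteq> W" using U(6)[of i "max (Suc i) (Suc j) - 1"] i by auto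
    moreover have "(x \<oplus> w) \<ominus> x = w" using x wG by (simp add: group_simps)
    ultimately show ?thesis
      using w x wG W(2) by (intro exI[of _ "x \<oplus> w"] exI[of _ "max (Suc i) (Suc j)"]) auto
  qed
  have "\<exists>s. \<forall>n. fst (s n) \<in> carrier G \<and>
      (snd (s n) < snd (s (Suc n)) \<and> fst (s (Suc n)) \<ominus> fst (s n) \<in> U (Suc (snd (s n))) \<and>
        (\<forall>w\<in>U (snd (s (Suc n)) - 1). fst (s (Suc n)) \<oplus> w \<notin> F n))"
  proof (rule dependent_nat_choice[where P = "\<lambda>n s. fst s \<in> carrier G"
        and Q = "\<lambda>n s s'. snd s < snd s' \<and> fst s' \<ominus> fst s \<in> U (Suc (snd s)) \<and>
          (\<forall>w\<in>U (snd s' - 1). fst s' \<oplus> w \<notin> F n)"])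
    show "\<exists>x. fst x \<in> carrier G" by (rule exI[of _ "(\<zero>, undefined)"]) simp
    fix s :: "'a \<times> nat" and n assume "fst s \<in> carrier G"
    from step[OF this, of "snd s" n] show "\<exists>s'. fst s' \<in> carrier G \<and>
      snd s < snd s' \<and> fst s' \<ominus> fst s \<in> U (Suc (snd s)) \<and>
        (\<forall>w\<in>U (snd s' - 1). fst s' \<oplus> w \<notin> F n)" by auto
  qed
  then obtain s where s: "\<And>n. fst (s n) \<in> carrier G" "\<And>n. snd (s n) < snd (s (Suc n))"
      "\<And>n. fst (s (Suc n)) \<ominus> fst (s n) \<in> U (Suc (snd (s n)))"
      "\<And>n. \<forall>w\<in>U (snd (s (Suc n)) - 1). fst (s (Suc n)) \<oplus> w \<notin> F n"
    by meson
  define x where "x n = fst (s n)" for n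
  define j where "j n = snd (s n)" for n
  have x: "x n \<in> carrier G" and j: "j n < j (Suc n)"
    and xs: "x (Suc n) \<ominus> x n \<in> U (Suc (j n))"
    and F: "\<forall>w\<in>U (j (Suc n) - 1). x (Suc n) \<oplus> w \<notin> F n" for n
    unfolding x_def j_def by (rule s)+
  have jn: "n \<le> j n" for n
    using j by (simp add: strict_mono_Suc_iff strict_mono_imp_increasing)
  have dist: "x (k + m) \<ominus> x k \<in> U (j k)" for m k
  proof (induction m arbitrary: k)
    case 0
    have "x k \<ominus> x k = \<zero>" using x by (simp add: group_simps)
    then show ?case using neighbourhood_self[OF U(1)] by simp
  next
    case (Suc m)
    have "x (Suc k + m) \<ominus> x (Suc k) \<in> U (j (Suc k))" by (rule Suc)
    then have "x (Suc k + m) \<ominus> x (Suc k) \<in> U (Suc (j k))"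
      using U(6)[of "Suc (j k)" "j (Suc k)"] j[of k] by auto
    then have "(x (Suc k + m) \<ominus> x (Suc k)) \<oplus> (x (Suc k) \<ominus> x k) \<in> U (j k)"
      using U(3) xs by simp
    then show ?case using x by (simp add: group_simps)
  qed
  have cauchy: "\<exists>N. \<forall>m\<ge>N. \<forall>k\<ge>N. x m \<ominus> x k \<in> W" if W: "nb W" for W
  proof -
    obtain n where n: "U n \<subseteq> W" using U(5)[OF W] by meson
    have near: "x m \<ominus> x (Suc n) \<in> U (Suc n)" if "m \<ge> Suc n" for m
      using dist[of "Suc n" "m - Suc n"] U(6)[of "Suc n" "j (Suc n)"] jn[of "Suc n"] that by auto
    have "x m \<ominus> x k \<in> W" if "m \<ge> Suc n" "k \<ge> Suc n" for m k
    proof -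
      have "(x m \<ominus> x (Suc n)) \<ominus> (x k \<ominus> x (Suc n)) \<in> U n" using U(4) near that by simp
      moreover have "(x m \<ominus> x (Suc n)) \<ominus> (x k \<ominus> x (Suc n)) = x m \<ominus> x k"
        using x by (simp add: group_simps)
      ultimately show ?thesis using n by auto
    qed
    then show ?thesis by blast
  qed
  have "\<exists>l. limitin T x l sequentially"
    using complete x cauchy unfolding complete_group_iff_nb by auto
  then obtain l where l: "limitin T x l sequentially" ..
  then have lG: "l \<in> carrier G" by (simp add: limitin_iff_nb)
  have "l \<notin> F k" for k
  proof -
    obtain N where N: "\<And>n. n \<ge> N \<Longrightarrow> x n \<ominus> l \<in> U (j (Suc k))"
      using l U(1) unfolding limitin_iff_nb by meson
    obtain i where i: "j (Suc k) = Suc i" using j[of k] by (cases "j (Suc k)") auto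
    let ?d = "x (Suc k + N) \<ominus> x (Suc k)" and ?e = "x (Suc k + N) \<ominus> l"
    have "?d \<ominus> ?e \<in> U i" using dist[of "Suc k" N] N[of "Suc k + N"] U(4) i by simp
    then have "x (Suc k) \<oplus> (?d \<ominus> ?e) \<notin> F k" using F[of k] i by simp
    moreover have "x (Suc k) \<oplus> (?d \<ominus> ?e) = l" using x lG by (simp add: group_simps)
    ultimately show ?thesis by simp
  qed
  then show False using cover lG by blast
qed

end

section \<open>Complete rings with a base of subgroups\<close>

text \<open>The hypotheses on \<open>R\<close> other than those on units, nilpotent elements and ideals, with the
  countable base at zero and the base of subgroups merged into one decreasing sequence.\<close>

locale filtered_ring = cring R for R (structure) +
  fixes T and V :: "nat \<Rightarrow> 'a set"
  assumes topological_ring: "topological_ring R T"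
    and hausdorff: "Hausdorff_space T"
    and complete: "complete_group (add_monoid R) T"
    and V_subgroup: "subgroup (V n) (add_monoid R)"
    and V_neighbourhood: "neighbourhood T \<zero> (V n)"
    and V_Suc: "V (Suc n) \<subseteq> V n"
    and V_base: "neighbourhood T \<zero> W \<Longrightarrow> \<exists>n. V n \<subseteq> W"

sublocale filtered_ring \<subseteq> topological_abelian_group R T
  by unfold_locales (use topological_ring in \<open>simp add: topological_ring_def\<close>)

context filtered_ring begin

lemma V_carrier: "v \<in> V n \<Longrightarrow> v \<in> carrier R"
  using subgroup.subset[OF V_subgroup[of n]] by auto

lemma V_zero [simp]: "\<zero> \<in> V n"
  using subgroup.one_closed[OF V_subgroup[of n]] by simp

lemma V_add: "v \<in> V n \<Longrightarrow> w \<in> V n \<Longrightarrow> v \<oplus> w \<in> V n"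
  using subgroup.m_closed[OF V_subgroup[of n]] by simp

lemma V_uminus: "v \<in> V n \<Longrightarrow> \<ominus> v \<in> V n"
  using subgroup.m_inv_closed[OF V_subgroup[of n]] by (simp add: a_inv_def)

lemma V_diff: "v \<in> V n \<Longrightarrow> w \<in> V n \<Longrightarrow> v \<ominus> w \<in> V n"
  by (simp add: minus_eq V_add V_uminus)

lemma V_antimono: "m \<le> n \<Longrightarrow> V n \<subseteq> V m"
  using lift_Suc_antimono_le[of V m n] V_Suc by simp

lemma limitin_iff_V:
  "limitin T f l sequentially \<longleftrightarrow>
     l \<in> carrier R \<and> (\<forall>n. \<exists>N. \<forall>k\<ge>N. f k \<in> carrier R \<and> f k \<ominus> l \<in> V n)"
proof (intro iffI conjI allI)
  assume "limitin T f l sequentially"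
  then show "l \<in> carrier R" "\<exists>N. \<forall>k\<ge>N. f k \<in> carrier R \<and> f k \<ominus> l \<in> V n" for n
    using V_neighbourhood[of n] unfolding limitin_iff_nb by simp_all
next
  assume R: "l \<in> carrier R \<and> (\<forall>n. \<exists>N. \<forall>k\<ge>N. f k \<in> carrier R \<and> f k \<ominus> l \<in> V n)"
  have "\<exists>N. \<forall>k\<ge>N. f k \<in> carrier R \<and> f k \<ominus> l \<in> W" if W: "nb W" for W
  proof -
    obtain n where n: "V n \<subseteq> W" using V_base[OF W] ..
    obtain N where "\<forall>k\<ge>N. f k \<in> carrier R \<and> f k \<ominus> l \<in> V n" using conjunct2[OF R] by meson
    then show ?thesis using n by (intro exI[of _ N]) auto
  qed
  then show "limitin T f l sequentially" using R unfolding limitin_iff_nb by simp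
qed

lemma V_separates:
  assumes "x \<in> carrier R" "\<And>n. x \<in> V n"
  shows "x = \<zero>"
proof -
  have "limitin T (\<lambda>_. x) x sequentially" using assms by simp
  moreover have "limitin T (\<lambda>_. x) \<zero> sequentially"
    using assms by (simp add: limitin_iff_V minus_eq)
  ultimately show ?thesis
    by (rule limitin_Hausdorff_unique[OF _ _ trivial_limit_sequentially hausdorff])
qed

lemma mult_continuous_at_zero:
  assumes "s \<in> carrier R"
  shows "\<exists>A m. openin T A \<and> s \<in> A \<and> (\<forall>a\<in>A. \<forall>w\<in>V m. a \<otimes> w \<in> V n)"
proof -
  have cont: "continuous_map (prod_topology T T) T (\<lambda>(x, y). x \<otimes> y)"
    using topological_ring by (simp add: topological_ring_def)
  obtain U where U: "openin T U" "\<zero> \<in> U" "U \<subseteq> V n"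
    using V_neighbourhood[of n] unfolding neighbourhood_def by blast
  have "\<exists>A B. openin T A \<and> openin T B \<and> s \<in> A \<and> \<zero> \<in> B \<and> (\<forall>a\<in>A. \<forall>b\<in>B. a \<otimes> b \<in> U)"
    using continuous_map_prodD[OF cont, of s \<zero> U] assms U by simp
  then obtain A B where AB: "openin T A" "openin T B" "s \<in> A" "\<zero> \<in> B" "\<forall>a\<in>A. \<forall>b\<in>B. a \<otimes> b \<in> U"
    by meson
  obtain m where "V m \<subseteq> B" using V_base[OF openin_imp_neighbourhood[OF AB(2,4)]] ..
  then show ?thesis using AB U by (intro exI[of _ A] exI[of _ m]) auto
qed

lemma mult_small_left:
  assumes "r \<in> carrier R"
  shows "\<exists>m. \<forall>v\<in>V m. r \<otimes> v \<in> V n"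
  using mult_continuous_at_zero[OF assms, of n] by blast

lemma mult_small: "\<exists>m. \<forall>v\<in>V m. \<forall>w\<in>V m. v \<otimes> w \<in> V n"
proof -
  obtain A k where A: "openin T A" "\<zero> \<in> A" "\<forall>a\<in>A. \<forall>w\<in>V k. a \<otimes> w \<in> V n"
    using mult_continuous_at_zero[OF zero_closed, of n] by blast
  obtain m where "V m \<subseteq> A" using V_base[OF openin_imp_neighbourhood[OF A(1,2)]] ..
  then have "V (max k m) \<subseteq> A" "V (max k m) \<subseteq> V k"
    using V_antimono[of m "max k m"] V_antimono[of k "max k m"] by auto
  then show ?thesis using A(3) by (intro exI[of _ "max k m"]) blast
qed

lemma mult_small_finite:
  assumes "finite A" "c \<in> A \<rightarrow> carrier R"
  shows "\<exists>m. \<forall>a\<in>A. \<forall>v\<in>V m. v \<otimes> c a \<in> V n"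
  using assms
proof (induction A rule: finite_induct)
  case (insert a A)
  then obtain m where m: "\<forall>a\<in>A. \<forall>v\<in>V m. v \<otimes> c a \<in> V n" by auto
  have ca: "c a \<in> carrier R" using insert by auto
  then obtain k where k: "\<forall>v\<in>V k. c a \<otimes> v \<in> V n" using mult_small_left[of "c a" n] by meson
  have "\<forall>b\<in>insert a A. \<forall>v\<in>V (max m k). v \<otimes> c b \<in> V n"
    using m k V_antimono[of m "max m k"] V_antimono[of k "max m k"] ca m_comm[OF V_carrier ca] by auto
  then show ?case by blast
qed simp

text \<open>The ultrametric inequality: since \<open>V n\<close> is a subgroup, small steps add up to a small distance.\<close>

lemma diff_in_V_of_steps:
  assumes "\<And>k. s k \<in> carrier R" "\<And>k. N \<le> k \<Longrightarrow> s (Suc k) \<ominus> s k \<in> V n" "N \<le> k" "k \<le> m"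
  shows "s m \<ominus> s k \<in> V n"
  using assms(4)
proof (induction m rule: dec_induct)
  case base
  then show ?case using assms(1) by (simp add: group_simps)
next
  case (step m)
  have "(s (Suc m) \<ominus> s m) \<oplus> (s m \<ominus> s k) \<in> V n" by (rule V_add) (use step assms(2,3) in auto)
  then show ?case using assms(1) by (simp add: group_simps)
qed

lemma convergent_of_null_steps:
  assumes s: "\<And>k. s k \<in> carrier R" and step: "\<And>n. \<exists>N. \<forall>k\<ge>N. s (Suc k) \<ominus> s k \<in> V n"
  shows "\<exists>l. limitin T s l sequentially"
proof -
  have "\<exists>N. \<forall>m\<ge>N. \<forall>k\<ge>N. s m \<ominus> s k \<in> W" if W: "nb W" for W
  proof -
    obtain n where n: "V n \<subseteq> W" using V_base[OF W] ..
    obtain N where N: "\<forall>k\<ge>N. s (Suc k) \<ominus> s k \<in> V n" using step by meson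
    have "s m \<ominus> s k \<in> V n" if mk: "N \<le> m" "N \<le> k" for m k
    proof -
      have d: "s i \<ominus> s N \<in> V n" if "N \<le> i" for i
        using diff_in_V_of_steps[of s N n N i, OF s] N that by simp
      have "(s m \<ominus> s N) \<ominus> (s k \<ominus> s N) \<in> V n" by (rule V_diff) (use mk d in auto)
      then show ?thesis using s by (simp add: group_simps)
    qed
    then show ?thesis using n by blast
  qed
  then show ?thesis using complete s unfolding complete_group_iff_nb by auto
qed

text \<open>The prescribed rate of convergence is what is needed when coefficients are built step by step:
  the limit is as close to each approximation as the next step is.\<close>

lemma limit_near_steps:
  assumes s: "\<And>k. s k \<in> carrier R" and step: "\<And>k. s (Suc k) \<ominus> s k \<in> V (n + k)"
  shows "\<exists>c\<in>carrier R. \<forall>k. c \<ominus> s k \<in> V (n + k)"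
proof -
  have anti: "s (Suc k) \<ominus> s k \<in> V m" if "m \<le> n + k" for m k
    using step[of k] V_antimono[OF that] by auto
  then have "\<exists>l. limitin T s l sequentially" by (intro convergent_of_null_steps[OF s] exI allI impI) (rule anti, erule trans_le_add2)
  then obtain l where "limitin T s l sequentially" ..
  then have l: "l \<in> carrier R" "\<And>m. \<exists>N. \<forall>k\<ge>N. s k \<ominus> l \<in> V m"
    unfolding limitin_iff_V by meson+
  have "l \<ominus> s k \<in> V (n + k)" for k
  proof -
    obtain N where N: "\<forall>m\<ge>N. s m \<ominus> l \<in> V (n + k)" using l by meson
    have "(s (max N k) \<ominus> s k) \<ominus> (s (max N k) \<ominus> l) \<in> V (n + k)"
      by (rule V_diff) (use N diff_in_V_of_steps[of s k "n + k" k "max N k", OF s] anti in auto)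
    then show ?thesis using s l by (simp add: group_simps)
  qed
  then show ?thesis using l by blast
qed

text \<open>The inverse is the limit of the geometric series; its partial sums converge because their steps
  \<open>r^n\<close> tend to zero.\<close>

lemma one_minus_nilpotent_unit:
  assumes "topologically_nilpotent R T r"
  shows "\<one> \<ominus> r \<in> Units R"
proof -
  have r: "r \<in> carrier R" and lim: "\<And>n. \<exists>N. \<forall>k::nat\<ge>N. r [^] k \<ominus> \<zero> \<in> V n"
    using assms unfolding topologically_nilpotent_def limitin_iff_V by meson+
  have small: "\<exists>N. \<forall>k::nat\<ge>N. r [^] k \<in> V n" for n
    using lim[of n] r by (simp add: minus_eq)
  define s where "s n = (\<Oplus>i\<in>{..n}. r [^] i)" for n :: nat
  have sR: "s n \<in> carrier R" for n using r unfolding s_def by (intro finsum_closed) auto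
  have s_Suc: "s (Suc n) = r [^] Suc n \<oplus> s n" for n
    unfolding s_def using r by (intro finsum_Suc) auto
  have tele: "(\<one> \<ominus> r) \<otimes> s n = \<one> \<ominus> r [^] Suc n" for n
  proof (induction n)
    case 0
    show ?case using r by (simp add: s_def)
  next
    case (Suc n)
    have p: "r [^] Suc n \<in> carrier R" using r by simp
    have "(\<one> \<ominus> r) \<otimes> s (Suc n) = (\<one> \<ominus> r) \<otimes> r [^] Suc n \<oplus> (\<one> \<ominus> r) \<otimes> s n"
      unfolding s_Suc using r p sR by (simp add: r_distr)
    also have "\<dots> = (\<one> \<ominus> r) \<otimes> r [^] Suc n \<oplus> (\<one> \<ominus> r [^] Suc n)" using Suc by simp
    also have "(\<one> \<ominus> r) \<otimes> r [^] Suc n = r [^] Suc n \<ominus> r [^] Suc (Suc n)"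
      using r by (simp add: minus_eq r_distr r_minus l_minus m_ac)
    also have "\<dots> \<oplus> (\<one> \<ominus> r [^] Suc n) = \<one> \<ominus> r [^] Suc (Suc n)"
      using r p nat_pow_closed[OF r, of "Suc (Suc n)"] by (simp add: group_simps del: nat_pow_Suc)
    finally show ?case .
  qed
  have step: "\<exists>N. \<forall>k\<ge>N. s (Suc k) \<ominus> s k \<in> V n" for n
  proof -
    obtain N where N: "\<forall>k::nat\<ge>N. r [^] k \<in> V n" using small by meson
    have "s (Suc k) \<ominus> s k \<in> V n" if "k \<ge> N" for k
    proof -
      have "s (Suc k) \<ominus> s k = r [^] Suc k"
        unfolding s_Suc using sR[of k] nat_pow_closed[OF r, of "Suc k"]
        by (simp add: group_simps del: nat_pow_Suc)
      then show ?thesis using N[rule_format, of "Suc k"] that by (simp only:)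
    qed
    then show ?thesis by blast
  qed
  obtain l where "limitin T s l sequentially" using convergent_of_null_steps[OF sR step] ..
  then have l: "l \<in> carrier R" "\<And>n. \<exists>N. \<forall>k\<ge>N. s k \<ominus> l \<in> V n"
    unfolding limitin_iff_V by meson+
  have "\<one> \<ominus> (\<one> \<ominus> r) \<otimes> l \<in> V n" for n
  proof -
    obtain m where m: "\<forall>v\<in>V m. (\<one> \<ominus> r) \<otimes> v \<in> V n" using mult_small_left[of "\<one> \<ominus> r" n] r by auto
    obtain N1 where N1: "\<forall>k\<ge>N1. s k \<ominus> l \<in> V m" using l by meson
    obtain N2 where N2: "\<forall>k::nat\<ge>N2. r [^] k \<in> V n" using small by meson
    define k where "k = max N1 N2"
    have p: "r [^] Suc k \<in> carrier R" using r by simp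
    have "(\<one> \<ominus> r) \<otimes> (s k \<ominus> l) \<oplus> r [^] Suc k \<in> V n"
    proof (rule V_add)
      show "(\<one> \<ominus> r) \<otimes> (s k \<ominus> l) \<in> V n" using m N1 by (simp add: k_def)
      have "N2 \<le> Suc k" by (simp add: k_def)
      then show "r [^] Suc k \<in> V n" by (rule N2[rule_format])
    qed
    also have "(\<one> \<ominus> r) \<otimes> (s k \<ominus> l) = (\<one> \<ominus> r) \<otimes> s k \<ominus> (\<one> \<ominus> r) \<otimes> l"
      using r sR l by (simp add: minus_eq r_distr r_minus)
    also have "\<dots> \<oplus> r [^] Suc k = \<one> \<ominus> (\<one> \<ominus> r) \<otimes> l"
      unfolding tele using r l p m_closed[OF minus_closed[OF one_closed r] l(1)]
      by (simp add: minus_eq[of _ "r [^] _"] minus_eq[of _ "_ \<otimes> _"] a_ac r_neg1 r_neg2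
        add_cancel_2 add_cancel_3 l_neg r_neg del: nat_pow_Suc)
    finally show ?thesis .
  qed
  then have z: "\<one> \<ominus> (\<one> \<ominus> r) \<otimes> l = \<zero>" using V_separates r l by simp
  then have "(\<one> \<ominus> r) \<otimes> l = \<one>" using r l by simp
  moreover from this have "l \<otimes> (\<one> \<ominus> r) = \<one>" using r l m_comm[of l "\<one> \<ominus> r"] by simp
  ultimately show ?thesis using r l unfolding Units_def by auto
qed

end

section \<open>Linear combinations of a set of generators\<close>

definition lincomb :: "('a, 'b, 'n) module_scheme \<Rightarrow> 'b set \<Rightarrow> ('b \<Rightarrow> 'a) \<Rightarrow> 'b" where
  "lincomb M E c = (\<Oplus>\<^bsub>M\<^esub>e\<in>E. c e \<odot>\<^bsub>M\<^esub> e)"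

text \<open>The image of \<open>C^E\<close> under the map \<open>R^E \<rightarrow> M\<close> given by the elements of \<open>E\<close>. With \<open>C\<close> the whole
  ring it is the submodule generated by \<open>E\<close>, with \<open>C = V n\<close> it is a basic neighbourhood of zero of
  the quotient topology.\<close>

definition lincombs :: "('a, 'b, 'n) module_scheme \<Rightarrow> 'b set \<Rightarrow> 'a set \<Rightarrow> 'b set" where
  "lincombs M E C = lincomb M E ` (E \<rightarrow> C)"

context module begin

context
  fixes E
  assumes E: "E \<subseteq> carrier M"
begin

lemma lincomb_closed:
  assumes "c \<in> E \<rightarrow> carrier R"
  shows "lincomb M E c \<in> carrier M"
  unfolding lincomb_def using assms E by (intro M.finsum_closed) auto

lemma lincomb_zero: "lincomb M E (\<lambda>_. \<zero>) = \<zero>\<^bsub>M\<^esub>"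
  unfolding lincomb_def using E by (intro M.add.finprod_one_eqI[simplified]) auto

lemma lincomb_add:
  assumes "c \<in> E \<rightarrow> carrier R" "d \<in> E \<rightarrow> carrier R"
  shows "lincomb M E (\<lambda>e. c e \<oplus> d e) = lincomb M E c \<oplus>\<^bsub>M\<^esub> lincomb M E d"
proof -
  have "lincomb M E (\<lambda>e. c e \<oplus> d e) = (\<Oplus>\<^bsub>M\<^esub>e\<in>E. c e \<odot>\<^bsub>M\<^esub> e \<oplus>\<^bsub>M\<^esub> d e \<odot>\<^bsub>M\<^esub> e)"
    unfolding lincomb_def using assms E by (intro M.finsum_cong') (auto simp: smult_l_distr subset_iff Pi_iff)
  also have "\<dots> = lincomb M E c \<oplus>\<^bsub>M\<^esub> lincomb M E d"
    unfolding lincomb_def using assms E by (intro M.finsum_addf) (auto simp: subset_iff Pi_iff)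
  finally show ?thesis .
qed

lemma lincomb_smult:
  assumes "finite E" "c \<in> E \<rightarrow> carrier R" "r \<in> carrier R"
  shows "lincomb M E (\<lambda>e. r \<otimes> c e) = r \<odot>\<^bsub>M\<^esub> lincomb M E c"
proof -
  have "lincomb M E (\<lambda>e. r \<otimes> c e) = (\<Oplus>\<^bsub>M\<^esub>e\<in>E. r \<odot>\<^bsub>M\<^esub> (c e \<odot>\<^bsub>M\<^esub> e))"
    unfolding lincomb_def using assms E by (intro M.finsum_cong') (auto simp: smult_assoc1 subset_iff Pi_iff)
  also have "\<dots> = r \<odot>\<^bsub>M\<^esub> lincomb M E c"
    unfolding lincomb_def using assms E by (intro finsum_smult_ldistr[symmetric]) (auto simp: subset_iff Pi_iff)
  finally show ?thesis .
qed

lemma lincomb_uminus: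
  assumes "finite E" "c \<in> E \<rightarrow> carrier R"
  shows "lincomb M E (\<lambda>e. \<ominus> c e) = \<ominus>\<^bsub>M\<^esub> lincomb M E c"
proof -
  have "lincomb M E (\<lambda>e. \<ominus> c e) = lincomb M E (\<lambda>e. (\<ominus> \<one>) \<otimes> c e)"
    unfolding lincomb_def using assms E
    by (intro M.finsum_cong') (auto simp: subset_iff Pi_iff R.l_minus)
  also have "\<dots> = (\<ominus> \<one>) \<odot>\<^bsub>M\<^esub> lincomb M E c" using assms by (intro lincomb_smult) auto
  also have "\<dots> = \<ominus>\<^bsub>M\<^esub> lincomb M E c"
    using lincomb_closed[OF assms(2)] by (simp add: smult_l_minus)
  finally show ?thesis .
qed

lemma lincomb_diff:
  assumes "finite E" "c \<in> E \<rightarrow> carrier R" "d \<in> E \<rightarrow> carrier R"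
  shows "lincomb M E (\<lambda>e. c e \<ominus> d e) = lincomb M E c \<ominus>\<^bsub>M\<^esub> lincomb M E d"
  unfolding R.minus_eq M.minus_eq using assms
  by (subst lincomb_add) (auto simp: lincomb_uminus Pi_iff)

lemma lincomb_insert:
  assumes "finite E" "e \<in> carrier M" "e \<notin> E" "c \<in> insert e E \<rightarrow> carrier R"
  shows "lincomb M (insert e E) c = c e \<odot>\<^bsub>M\<^esub> e \<oplus>\<^bsub>M\<^esub> lincomb M E c"
  unfolding lincomb_def using assms E by (subst M.finsum_insert) (auto simp: Pi_iff subset_iff)

lemma lincomb_single:
  assumes "finite E" "e \<in> E" "r \<in> carrier R"
  shows "lincomb M E (\<lambda>x. if x = e then r else \<zero>) = r \<odot>\<^bsub>M\<^esub> e"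
proof -
  have "lincomb M E (\<lambda>x. if x = e then r else \<zero>) = (\<Oplus>\<^bsub>M\<^esub>x\<in>E. if e = x then r \<odot>\<^bsub>M\<^esub> x else \<zero>\<^bsub>M\<^esub>)"
    unfolding lincomb_def using assms E by (intro M.finsum_cong') (auto simp: subset_iff)
  also have "\<dots> = r \<odot>\<^bsub>M\<^esub> e"
    using M.finsum_singleton[of e E "\<lambda>x. r \<odot>\<^bsub>M\<^esub> x"] assms E by (auto simp: subset_iff)
  finally show ?thesis .
qed

lemma lincombs_carrier: "C \<subseteq> carrier R \<Longrightarrow> lincombs M E C \<subseteq> carrier M"
  unfolding lincombs_def using lincomb_closed by blast

lemma submodule_lincomb_closed:
  assumes "finite E" "submodule P R M" "E \<subseteq> P" "c \<in> E \<rightarrow> carrier R"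
  shows "lincomb M E c \<in> P"
  using assms(1,3,4) E
proof (induction E rule: finite_induct)
  case empty
  then show ?case
    using subgroup.one_closed[OF submodule.axioms(1)[OF assms(2)]] by (simp add: lincomb_def)
next
  case (insert e E)
  then have "c e \<odot>\<^bsub>M\<^esub> e \<in> P" "lincomb M E c \<in> P" using submoduleE(4)[OF assms(2)] by auto
  then have "c e \<odot>\<^bsub>M\<^esub> e \<oplus>\<^bsub>M\<^esub> lincomb M E c \<in> P" by (rule submoduleE(5)[OF assms(2)])
  then show ?case
    using insert unfolding lincomb_def by (subst M.finsum_insert) (auto simp: Pi_iff subset_iff)
qed

lemma submodule_lincombs:
  assumes "finite E"
  shows "submodule (lincombs M E (carrier R)) R M" "E \<subseteq> lincombs M E (carrier R)"
proof -
  let ?L = "lincombs M E (carrier R)"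
  have LI: "lincomb M E c \<in> ?L" if "c \<in> E \<rightarrow> carrier R" for c
    using that unfolding lincombs_def by blast
  show "submodule ?L R M"
  proof (rule submoduleI)
    show "?L \<subseteq> carrier M" by (rule lincombs_carrier) simp
    show "\<zero>\<^bsub>M\<^esub> \<in> ?L" using LI[of "\<lambda>_. \<zero>"] by (simp add: lincomb_zero)
  next
    fix x assume "x \<in> ?L"
    then obtain c where c: "c \<in> E \<rightarrow> carrier R" "x = lincomb M E c" unfolding lincombs_def by blast
    then show "\<ominus>\<^bsub>M\<^esub> x \<in> ?L"
      using LI[of "\<lambda>e. \<ominus> c e"] by (simp add: lincomb_uminus[OF assms] Pi_iff)
    fix r assume "r \<in> carrier R"
    then show "r \<odot>\<^bsub>M\<^esub> x \<in> ?L"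
      using LI[of "\<lambda>e. r \<otimes> c e"] c by (simp add: lincomb_smult[OF assms] Pi_iff)
  next
    fix x y assume "x \<in> ?L" "y \<in> ?L"
    then obtain c d where "c \<in> E \<rightarrow> carrier R" "x = lincomb M E c"
      "d \<in> E \<rightarrow> carrier R" "y = lincomb M E d" unfolding lincombs_def by blast
    then show "x \<oplus>\<^bsub>M\<^esub> y \<in> ?L"
      using LI[of "\<lambda>e. c e \<oplus> d e"] by (simp add: lincomb_add Pi_iff)
  qed
  show "E \<subseteq> ?L"
  proof
    fix e assume "e \<in> E"
    then show "e \<in> ?L"
      using LI[of "\<lambda>x. if x = e then \<one> else \<zero>"] lincomb_single[OF assms, of e \<one>] E by auto
  qed
qed

end
end

section \<open>The open mapping theorem\<close>

context topological_abelian_group begin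

lemma closure_diff_closed:
  assumes H: "H \<subseteq> carrier G" "\<And>a b. a \<in> H \<Longrightarrow> b \<in> H \<Longrightarrow> a \<ominus> b \<in> H"
    and xy: "x \<in> T closure_of H" "y \<in> T closure_of H"
  shows "x \<ominus> y \<in> T closure_of H"
proof -
  have x: "x \<in> carrier G" "\<And>W. nb W \<Longrightarrow> \<exists>a\<in>H. x \<ominus> a \<in> W"
    and y: "y \<in> carrier G" "\<And>W. nb W \<Longrightarrow> \<exists>a\<in>H. y \<ominus> a \<in> W"
    using xy unfolding in_closure_iff_nb[OF H(1)] by simp_all
  have "\<exists>c\<in>H. (x \<ominus> y) \<ominus> c \<in> W" if W: "nb W" for W
  proof -
    obtain W' where W': "nb W'" "\<forall>x\<in>W'. \<forall>y\<in>W'. x \<oplus> y \<in> W \<and> x \<ominus> y \<in> W"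
      using nb_halving[OF W] by blast
    obtain a where a: "a \<in> H" "x \<ominus> a \<in> W'" using x(2)[OF W'(1)] ..
    obtain b where b: "b \<in> H" "y \<ominus> b \<in> W'" using y(2)[OF W'(1)] ..
    have ab: "a \<in> carrier G" "b \<in> carrier G" using a b H(1) by auto
    have "(x \<ominus> a) \<ominus> (y \<ominus> b) \<in> W" using W'(2) a b by simp
    moreover have "(x \<ominus> a) \<ominus> (y \<ominus> b) = (x \<ominus> y) \<ominus> (a \<ominus> b)"
      using x y ab by (simp add: group_simps)
    ultimately show ?thesis using H(2)[OF a(1) b(1)] by auto
  qed
  then show ?thesis unfolding in_closure_iff_nb[OF H(1)] using x y by simp
qed

lemma nb_separates:
  assumes "Hausdorff_space T" "x \<in> carrier G" "\<And>W. nb W \<Longrightarrow> x \<in> W"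
  shows "x = \<zero>"
proof -
  have "limitin T (\<lambda>_. x) x sequentially" using assms by simp
  moreover have "limitin T (\<lambda>_. x) \<zero> sequentially"
    using assms by (simp add: limitin_iff_nb minus_eq uminus_zero)
  ultimately show ?thesis
    by (rule limitin_Hausdorff_unique[OF _ _ trivial_limit_sequentially assms(1)])
qed

end

locale filtered_ring_module = module R M + filtered_ring R T V for R (structure) and T V and M (structure) +
  fixes S
  assumes topological_module: "topological_module R T M S"

sublocale filtered_ring_module \<subseteq> S: topological_abelian_group M S
  by unfold_locales (use topological_module in \<open>simp add: topological_module_def\<close>)

context filtered_ring_module begin

lemma smult_continuous: "continuous_map (prod_topology T S) S (\<lambda>(r, x). r \<odot>\<^bsub>M\<^esub> x)"
  using topological_module by (simp add: topological_module_def)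

lemma smult_left_continuous:
  assumes "r \<in> carrier R"
  shows "continuous_map S S (\<lambda>x. r \<odot>\<^bsub>M\<^esub> x)"
proof -
  have "continuous_map S (prod_topology T S) (\<lambda>x. (r, x))"
    using assms by (auto simp: continuous_map_paired)
  from continuous_map_compose[OF this smult_continuous]
  show ?thesis by (simp add: comp_def)
qed

lemma nb_smult_left:
  assumes "r \<in> carrier R" "S.nb W"
  shows "\<exists>W'. S.nb W' \<and> (\<forall>w\<in>W'. r \<odot>\<^bsub>M\<^esub> w \<in> W)"
proof -
  obtain U where U: "openin S U" "\<zero>\<^bsub>M\<^esub> \<in> U" "U \<subseteq> W"
    using assms(2) unfolding neighbourhood_def by blast
  have "openin S {x \<in> carrier M. r \<odot>\<^bsub>M\<^esub> x \<in> U}"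
    using openin_continuous_map_preimage[OF smult_left_continuous[OF assms(1)] U(1)] by simp
  then have "S.nb {x \<in> carrier M. r \<odot>\<^bsub>M\<^esub> x \<in> U}"
    using assms U by (intro openin_imp_neighbourhood) auto
  then show ?thesis using U by (intro exI[of _ "{x \<in> carrier M. r \<odot>\<^bsub>M\<^esub> x \<in> U}"]) auto
qed

lemma nb_smult_right:
  assumes "x \<in> carrier M" "S.nb W"
  shows "\<exists>n. \<forall>v\<in>V n. v \<odot>\<^bsub>M\<^esub> x \<in> W"
proof -
  obtain U where U: "openin S U" "\<zero>\<^bsub>M\<^esub> \<in> U" "U \<subseteq> W"
    using assms(2) unfolding neighbourhood_def by blast
  have "\<exists>A B. openin T A \<and> openin S B \<and> \<zero> \<in> A \<and> x \<in> B \<and> (\<forall>a\<in>A. \<forall>b\<in>B. a \<odot>\<^bsub>M\<^esub> b \<in> U)"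
    using continuous_map_prodD[OF smult_continuous, of \<zero> x U] U assms by simp
  then obtain A B where A: "openin T A" "\<zero> \<in> A" "x \<in> B" "\<forall>a\<in>A. \<forall>b\<in>B. a \<odot>\<^bsub>M\<^esub> b \<in> U"
    by meson
  obtain n where "V n \<subseteq> A" using V_base[OF openin_imp_neighbourhood[OF A(1,2)]] ..
  then show ?thesis using A U by (intro exI[of _ n]) auto
qed

text \<open>Continuity of the map \<open>R^E \<rightarrow> M\<close> at zero.\<close>

lemma nb_lincombs:
  assumes "finite E" "E \<subseteq> carrier M" "S.nb W"
  shows "\<exists>n. lincombs M E (V n) \<subseteq> W"
  using assms
proof (induction E arbitrary: W rule: finite_induct)
  case empty
  then show ?case using neighbourhood_self by (auto simp: lincombs_def lincomb_def)
next
  case (insert e E)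
  obtain W' where W': "S.nb W'" "\<forall>x\<in>W'. \<forall>y\<in>W'. x \<oplus>\<^bsub>M\<^esub> y \<in> W \<and> x \<ominus>\<^bsub>M\<^esub> y \<in> W"
    using S.nb_halving[OF insert.prems(2)] by blast
  obtain n where n: "lincombs M E (V n) \<subseteq> W'" using insert W'(1) by blast
  obtain m where m: "\<forall>v\<in>V m. v \<odot>\<^bsub>M\<^esub> e \<in> W'" using nb_smult_right[of e, OF _ W'(1)] insert by auto
  have "lincomb M (insert e E) c \<in> W" if c: "c \<in> insert e E \<rightarrow> V (max n m)" for c
  proof -
    have "c \<in> E \<rightarrow> V n" "c e \<in> V m"
      using c V_antimono[of n "max n m"] V_antimono[of m "max n m"] by (auto simp: Pi_iff)
    then have "lincomb M E c \<in> W'" "c e \<odot>\<^bsub>M\<^esub> e \<in> W'" using n m unfolding lincombs_def by auto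
    then have "c e \<odot>\<^bsub>M\<^esub> e \<oplus>\<^bsub>M\<^esub> lincomb M E c \<in> W" using W' by simp
    then show ?thesis using insert c V_carrier by (subst lincomb_insert) (auto simp: Pi_iff)
  qed
  then show ?case unfolding lincombs_def by blast
qed

end

locale complete_filtered_ring_module = filtered_ring_module R T V M S
  for R (structure) and T V and M (structure) and S +
  fixes u :: "nat \<Rightarrow> 'a"
  assumes hausdorff_module: "Hausdorff_space S"
    and complete_module: "complete_group (add_monoid M) S"
    and countable_base_module: "\<exists>B. countable B \<and> fundamental_system S \<zero>\<^bsub>M\<^esub> B"
    and unit: "u n \<in> Units R"
    and null_sequence: "limitin T u \<zero> sequentially"

sublocale complete_filtered_ring_module \<subseteq> S: complete_metrizable_group M S
  by unfold_locales (rule complete_module countable_base_module)+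

context complete_filtered_ring_module begin

context
  fixes E
  assumes E: "finite E" "E \<subseteq> carrier M" and gen: "lincombs M E (carrier R) = carrier M"
begin

lemma lincombs_V_carrier: "lincombs M E (V n) \<subseteq> carrier M"
  using lincombs_carrier[OF E(2)] V_carrier by blast

lemma lincombs_V_diff:
  assumes "a \<in> lincombs M E (V n)" "b \<in> lincombs M E (V n)"
  shows "a \<ominus>\<^bsub>M\<^esub> b \<in> lincombs M E (V n)"
proof -
  obtain c d where c: "c \<in> E \<rightarrow> V n" "a = lincomb M E c" and d: "d \<in> E \<rightarrow> V n" "b = lincomb M E d"
    using assms unfolding lincombs_def by blast
  have "a \<ominus>\<^bsub>M\<^esub> b = lincomb M E (\<lambda>e. c e \<ominus> d e)"
    using c d V_carrier by (subst lincomb_diff[OF E(2,1)]) (auto simp: Pi_iff)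
  moreover have "(\<lambda>e. c e \<ominus> d e) \<in> E \<rightarrow> V n" using c d by (auto intro!: V_diff)
  ultimately show ?thesis unfolding lincombs_def by blast
qed

text \<open>Writing \<open>x\<close> as a combination of \<open>E\<close> with coefficients \<open>c\<close>, all the products \<open>u k c e\<close> lie in \<open>V n\<close> for
  large \<open>k\<close>, as \<open>u\<close> tends to zero and \<open>E\<close> is finite.\<close>

lemma absorbed_by_unit:
  assumes "x \<in> carrier M"
  shows "\<exists>k. u k \<odot>\<^bsub>M\<^esub> x \<in> lincombs M E (V n)"
proof -
  obtain c where c: "c \<in> E \<rightarrow> carrier R" "x = lincomb M E c"
    using assms gen unfolding lincombs_def by blast
  obtain m where m: "\<forall>e\<in>E. \<forall>v\<in>V m. v \<otimes> c e \<in> V n"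
    using mult_small_finite[OF E(1) c(1)] by meson
  obtain k where k: "u k \<in> carrier R" "u k \<ominus> \<zero> \<in> V m"
    using null_sequence unfolding limitin_iff_V by blast
  then have "u k \<in> V m" by (simp add: R.minus_eq)
  then have "(\<lambda>e. u k \<otimes> c e) \<in> E \<rightarrow> V n" using m by auto
  moreover have "lincomb M E (\<lambda>e. u k \<otimes> c e) = u k \<odot>\<^bsub>M\<^esub> x"
    using lincomb_smult[OF E(2,1) c(1) k(1)] c(2) by simp
  ultimately show ?thesis unfolding lincombs_def by (metis imageI)
qed

text \<open>The Baire step. Some \<open>{x. u k x \<in> closure (W n)}\<close> contains a coset of a neighbourhood of zero;
  subtracting its base point and multiplying by the unit \<open>u k\<close> moves this neighbourhood into the
  closure of \<open>W n\<close>.\<close>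

lemma closure_lincombs_nb: "S.nb (S closure_of lincombs M E (V n))" (is "S.nb ?C")
proof -
  have C_carrier: "?C \<subseteq> carrier M" using closure_of_subset_topspace[of S] by simp
  have C_sup: "lincombs M E (V n) \<subseteq> ?C" using lincombs_V_carrier by (intro closure_of_subset) simp
  define F where "F k = {x \<in> carrier M. u k \<odot>\<^bsub>M\<^esub> x \<in> ?C}" for k
  have uR: "u k \<in> carrier R" for k using unit by (rule Units_closed)
  have closed: "closedin S (F k)" for k
    unfolding F_def using closedin_continuous_map_preimage[OF smult_left_continuous[OF uR] closedin_closure_of] by simp
  have "\<exists>k. x \<in> F k" if x: "x \<in> carrier M" for x
    using absorbed_by_unit[OF x, of n] x C_sup unfolding F_def by blast
  then have cover: "carrier M \<subseteq> (\<Union>k. F k)" by blast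
  obtain k x W where k: "x \<in> carrier M" "S.nb W" "\<forall>w\<in>W. x \<oplus>\<^bsub>M\<^esub> w \<in> F k"
    using S.baire[OF closed cover] by meson
  have uW: "u k \<odot>\<^bsub>M\<^esub> w \<in> ?C" if w: "w \<in> W" for w
  proof -
    have wM: "w \<in> carrier M" using S.nb_subset[OF k(2)] w by auto
    have "x \<oplus>\<^bsub>M\<^esub> \<zero>\<^bsub>M\<^esub> \<in> F k" using k(3) neighbourhood_self[OF k(2)] by (rule bspec)
    then have "u k \<odot>\<^bsub>M\<^esub> (x \<oplus>\<^bsub>M\<^esub> w) \<in> ?C" "u k \<odot>\<^bsub>M\<^esub> x \<in> ?C" using k w unfolding F_def by simp_all
    then have "u k \<odot>\<^bsub>M\<^esub> (x \<oplus>\<^bsub>M\<^esub> w) \<ominus>\<^bsub>M\<^esub> u k \<odot>\<^bsub>M\<^esub> x \<in> ?C"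
      by (intro S.closure_diff_closed[OF lincombs_V_carrier lincombs_V_diff])
    also have "u k \<odot>\<^bsub>M\<^esub> (x \<oplus>\<^bsub>M\<^esub> w) \<ominus>\<^bsub>M\<^esub> u k \<odot>\<^bsub>M\<^esub> x = u k \<odot>\<^bsub>M\<^esub> w"
      using k(1) wM uR by (simp add: smult_r_distr M.group_simps)
    finally show ?thesis .
  qed
  obtain W' where W': "S.nb W'" "\<forall>w\<in>W'. inv (u k) \<odot>\<^bsub>M\<^esub> w \<in> W"
    using nb_smult_left[OF Units_inv_closed[OF unit] k(2)] by blast
  have "W' \<subseteq> ?C"
  proof
    fix w assume w: "w \<in> W'"
    then have wM: "w \<in> carrier M" using S.nb_subset[OF W'(1)] by auto
    have "u k \<odot>\<^bsub>M\<^esub> (inv (u k) \<odot>\<^bsub>M\<^esub> w) \<in> ?C" using uW W' w by simp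
    also have "u k \<odot>\<^bsub>M\<^esub> (inv (u k) \<odot>\<^bsub>M\<^esub> w) = w"
      using unit uR wM by (simp add: smult_assoc1[symmetric])
    finally show "w \<in> ?C" .
  qed
  then show ?thesis using neighbourhood_mono[OF W'(1)] C_carrier by simp
qed

text \<open>Successive approximation. The closures of all the \<open>W i\<close> are neighbourhoods of zero, so a point of
  the closure of \<open>W (n + i)\<close> can be corrected by an element of \<open>W (n + i)\<close> to lie in the closure of
  \<open>W (n + i + 1)\<close> and in \<open>U i\<close>. The coefficients of the corrections add up to elements of \<open>V n\<close>
  because \<open>R\<close> is complete and \<open>V n\<close> is closed.\<close>

lemma closure_lincombs: "S closure_of lincombs M E (V n) \<subseteq> lincombs M E (V n)"
proof
  fix y assume y: "y \<in> S closure_of lincombs M E (V n)"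
  then have yM: "y \<in> carrier M" using closure_of_subset_topspace[of S] by auto
  define C where "C i = S closure_of lincombs M E (V i)" for i
  have C: "S.nb (C i)" for i unfolding C_def by (rule closure_lincombs_nb)
  obtain U where "S.halving_base U" using S.halving_base_exists ..
  note U = S.halving_baseD[OF this]
  define P where "P i p \<longleftrightarrow> p \<in> E \<rightarrow> V n \<and> y \<ominus>\<^bsub>M\<^esub> lincomb M E p \<in> C (n + i)" for i p
  define Q where "Q i p q \<longleftrightarrow> (\<forall>e\<in>E. q e \<ominus> p e \<in> V (n + i)) \<and> y \<ominus>\<^bsub>M\<^esub> lincomb M E q \<in> U i" for i p q
  have step: "\<exists>q. P (Suc i) q \<and> Q i p q" if p: "P i p" for i p
  proof -
    let ?z = "y \<ominus>\<^bsub>M\<^esub> lincomb M E p"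
    have pV: "p \<in> E \<rightarrow> V n" and z: "?z \<in> C (n + i)" using p by (auto simp: P_def)
    then have pE: "p \<in> E \<rightarrow> carrier R" using V_carrier by auto
    have "S.nb (C (n + Suc i) \<inter> U i)" using C U(1) by (rule neighbourhood_Int)
    then obtain a where a: "a \<in> lincombs M E (V (n + i))" "?z \<ominus>\<^bsub>M\<^esub> a \<in> C (n + Suc i) \<inter> U i"
      using z unfolding C_def[of "n + i"] S.in_closure_iff_nb[OF lincombs_V_carrier] by blast
    then obtain d where d: "d \<in> E \<rightarrow> V (n + i)" "a = lincomb M E d" unfolding lincombs_def by blast
    have dR: "d \<in> E \<rightarrow> carrier R" using d V_carrier by auto
    let ?q = "\<lambda>e. p e \<oplus> d e"
    have "y \<ominus>\<^bsub>M\<^esub> lincomb M E ?q = ?z \<ominus>\<^bsub>M\<^esub> a"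
      using yM lincomb_closed[OF E(2) pE] lincomb_closed[OF E(2) dR]
      by (simp add: lincomb_add[OF E(2) pE dR] d M.group_simps)
    moreover have "?q e \<ominus> p e \<in> V (n + i)" if "e \<in> E" for e
    proof -
      have "p e \<in> carrier R" "d e \<in> carrier R" "d e \<in> V (n + i)" using that pE dR d by auto
      then show ?thesis by (simp add: R.group_simps)
    qed
    moreover have "?q \<in> E \<rightarrow> V n"
      using pV d V_antimono[of n "n + i"] by (auto intro!: V_add)
    ultimately show ?thesis using a unfolding P_def Q_def by (intro exI[of _ ?q]) auto
  qed
  have "P 0 (\<lambda>_. \<zero>)"
    using y yM unfolding P_def C_def
    by (simp add: lincomb_zero[OF E(2)] M.minus_eq M.uminus_zero)
  then have "\<exists>p. \<forall>i. P i (p i) \<and> Q i (p i) (p (Suc i))"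
    using step by (intro dependent_nat_choice) (rule exI)
  then obtain p where P: "\<And>i. P i (p i)" and Q: "\<And>i. Q i (p i) (p (Suc i))" by blast
  have pV: "p i \<in> E \<rightarrow> V n" for i using P unfolding P_def by simp
  then have pE: "p i \<in> E \<rightarrow> carrier R" for i using V_carrier[of _ n] by (simp add: Pi_iff)
  have "\<exists>c\<in>carrier R. \<forall>i. c \<ominus> p i e \<in> V (n + i)" if "e \<in> E" for e
  proof (rule limit_near_steps)
    show "p i e \<in> carrier R" for i using pE that by auto
    show "p (Suc k) e \<ominus> p k e \<in> V (n + k)" for k using Q that unfolding Q_def by simp
  qed
  then obtain c where c: "\<And>e. e \<in> E \<Longrightarrow> c e \<in> carrier R"
      "\<And>e i. e \<in> E \<Longrightarrow> c e \<ominus> p i e \<in> V (n + i)"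
    by metis
  have cR: "c \<in> E \<rightarrow> carrier R" using c(1) by simp
  have cV: "c e \<in> V n" if "e \<in> E" for e
  proof -
    have p0: "p 0 e \<in> V n" "p 0 e \<in> carrier R" using pV pE that by auto
    have "(c e \<ominus> p 0 e) \<oplus> p 0 e \<in> V n" using c(2)[OF that, of 0] p0 by (intro V_add) simp_all
    then show ?thesis using c(1)[OF that] p0 by (simp add: R.group_simps)
  qed
  have "y \<ominus>\<^bsub>M\<^esub> lincomb M E c \<in> W" if W: "S.nb W" for W
  proof -
    obtain W' where W': "S.nb W'" "\<forall>x\<in>W'. \<forall>y\<in>W'. x \<oplus>\<^bsub>M\<^esub> y \<in> W \<and> x \<ominus>\<^bsub>M\<^esub> y \<in> W"
      using S.nb_halving[OF W] by blast
    obtain i where i: "U i \<subseteq> W'" using U(5)[OF W'(1)] ..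
    obtain m where m: "lincombs M E (V m) \<subseteq> W'" using nb_lincombs[OF E W'(1)] ..
    define k where "k = max i m"
    let ?d = "\<lambda>e. c e \<ominus> p (Suc k) e"
    have "y \<ominus>\<^bsub>M\<^esub> lincomb M E (p (Suc k)) \<in> U k" using Q unfolding Q_def by simp
    then have a: "y \<ominus>\<^bsub>M\<^esub> lincomb M E (p (Suc k)) \<in> W'"
      using U(6)[of i k] i unfolding k_def by auto
    have "m \<le> n + Suc k" unfolding k_def by simp
    then have "?d \<in> E \<rightarrow> V m"
      by (intro Pi_I subsetD[OF V_antimono[of m "n + Suc k"] c(2)])
    then have b: "lincomb M E ?d \<in> W'" using m unfolding lincombs_def by auto
    have "y \<ominus>\<^bsub>M\<^esub> lincomb M E c = (y \<ominus>\<^bsub>M\<^esub> lincomb M E (p (Suc k))) \<ominus>\<^bsub>M\<^esub> lincomb M E ?d"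
      unfolding lincomb_diff[OF E(2,1) cR pE]
      using yM lincomb_closed[OF E(2) cR] lincomb_closed[OF E(2) pE[of "Suc k"]]
      by (simp add: M.group_simps)
    then show ?thesis using W'(2) a b by simp
  qed
  then have "y \<ominus>\<^bsub>M\<^esub> lincomb M E c = \<zero>\<^bsub>M\<^esub>"
    using S.nb_separates[OF hausdorff_module] yM lincomb_closed[OF E(2) cR] by simp
  then have "y = lincomb M E c" by (rule M.eq_of_diff_eq_zero[OF yM lincomb_closed[OF E(2) cR]])
  then show "y \<in> lincombs M E (V n)" using cV unfolding lincombs_def by auto
qed

text \<open>The open mapping theorem for \<open>R^E \<rightarrow> M\<close>, at the point zero.\<close>

lemma lincombs_nb: "S.nb (lincombs M E (V n))"
  using neighbourhood_mono[OF closure_lincombs_nb closure_lincombs] lincombs_V_carrier by simp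

end
end

section \<open>Topologies defined by a decreasing sequence of subgroups\<close>

definition subgroup_topology :: "('a, 'm) ring_scheme \<Rightarrow> (nat \<Rightarrow> 'a set) \<Rightarrow> 'a topology" where
  "subgroup_topology G W =
     topology (\<lambda>U. U \<subseteq> carrier G \<and> (\<forall>x\<in>U. \<exists>n. \<forall>w\<in>W n. x \<oplus>\<^bsub>G\<^esub> w \<in> U))"

locale subgroup_filtration = abelian_group G for G (structure) +
  fixes W :: "nat \<Rightarrow> 'a set"
  assumes W_subgroup: "subgroup (W n) (add_monoid G)"
    and W_Suc: "W (Suc n) \<subseteq> W n"
begin

abbreviation "S \<equiv> subgroup_topology G W"

lemma W_carrier: "v \<in> W n \<Longrightarrow> v \<in> carrier G"
  using subgroup.subset[OF W_subgroup[of n]] by auto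

lemma W_zero [simp]: "\<zero> \<in> W n"
  using subgroup.one_closed[OF W_subgroup[of n]] by simp

lemma W_add: "v \<in> W n \<Longrightarrow> w \<in> W n \<Longrightarrow> v \<oplus> w \<in> W n"
  using subgroup.m_closed[OF W_subgroup[of n]] by simp

lemma W_uminus: "v \<in> W n \<Longrightarrow> \<ominus> v \<in> W n"
  using subgroup.m_inv_closed[OF W_subgroup[of n]] by (simp add: a_inv_def)

lemma W_diff: "v \<in> W n \<Longrightarrow> w \<in> W n \<Longrightarrow> v \<ominus> w \<in> W n"
  by (simp add: minus_eq W_add W_uminus)

lemma W_antimono: "m \<le> n \<Longrightarrow> W n \<subseteq> W m"
  using lift_Suc_antimono_le[of W m n] W_Suc by simp

lemma openin_S: "openin S U \<longleftrightarrow> U \<subseteq> carrier G \<and> (\<forall>x\<in>U. \<exists>n. \<forall>w\<in>W n. x \<oplus> w \<in> U)"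
proof -
  have "istopology (\<lambda>U. U \<subseteq> carrier G \<and> (\<forall>x\<in>U. \<exists>n. \<forall>w\<in>W n. x \<oplus> w \<in> U))"
    unfolding istopology_def
  proof (intro conjI allI impI ballI)
    fix A B x
    assume A: "A \<subseteq> carrier G \<and> (\<forall>x\<in>A. \<exists>n. \<forall>w\<in>W n. x \<oplus> w \<in> A)"
      and B: "B \<subseteq> carrier G \<and> (\<forall>x\<in>B. \<exists>n. \<forall>w\<in>W n. x \<oplus> w \<in> B)"
    then show "A \<inter> B \<subseteq> carrier G" by blast
    assume "x \<in> A \<inter> B"
    then obtain n m where "\<forall>w\<in>W n. x \<oplus> w \<in> A" "\<forall>w\<in>W m. x \<oplus> w \<in> B" using A B by blast
    then show "\<exists>n. \<forall>w\<in>W n. x \<oplus> w \<in> A \<inter> B"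
      using W_antimono[of n "max n m"] W_antimono[of m "max n m"]
      by (intro exI[of _ "max n m"]) auto
  next
    fix K x
    assume K: "\<forall>U\<in>K. U \<subseteq> carrier G \<and> (\<forall>x\<in>U. \<exists>n. \<forall>w\<in>W n. x \<oplus> w \<in> U)"
    then show "\<Union>K \<subseteq> carrier G" by blast
    assume "x \<in> \<Union>K"
    then obtain U where U: "U \<in> K" "x \<in> U" by blast
    then obtain n where n: "\<forall>w\<in>W n. x \<oplus> w \<in> U" using K by meson
    show "\<exists>n. \<forall>w\<in>W n. x \<oplus> w \<in> \<Union>K" using n U(1) by (intro exI[of _ n]) auto
  qed
  then show ?thesis unfolding subgroup_topology_def by simp
qed

lemma openin_SD: "openin S U \<Longrightarrow> x \<in> U \<Longrightarrow> \<exists>n. \<forall>w\<in>W n. x \<oplus> w \<in> U"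
  unfolding openin_S by simp

lemma topspace_S [simp]: "topspace S = carrier G"
proof -
  have "openin S (carrier G)" unfolding openin_S using W_carrier by auto
  moreover have "topspace S \<subseteq> carrier G" using openin_topspace[of S] unfolding openin_S by simp
  ultimately show ?thesis using openin_subset by blast
qed

lemma openin_coset: "x \<in> carrier G \<Longrightarrow> openin S ((\<lambda>w. x \<oplus> w) ` W n)"
  unfolding openin_S
proof (intro conjI ballI)
  assume x: "x \<in> carrier G"
  then show "(\<lambda>w. x \<oplus> w) ` W n \<subseteq> carrier G" using W_carrier by auto
  fix y assume "y \<in> (\<lambda>w. x \<oplus> w) ` W n"
  then obtain w where w: "w \<in> W n" "y = x \<oplus> w" by blast
  have "y \<oplus> v \<in> (\<lambda>w. x \<oplus> w) ` W n" if v: "v \<in> W n" for v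
  proof (rule image_eqI)
      show "w \<oplus> v \<in> W n" by (rule W_add[OF w(1) v])
      show "y \<oplus> v = x \<oplus> (w \<oplus> v)"
        using w(2) x W_carrier[OF w(1)] W_carrier[OF v] by (simp add: a_assoc)
    qed
  then show "\<exists>n'. \<forall>v\<in>W n'. y \<oplus> v \<in> (\<lambda>w. x \<oplus> w) ` W n" by (intro exI ballI)
qed

lemma openin_W: "openin S (W n)"
  unfolding openin_S
proof (intro conjI ballI)
  show "W n \<subseteq> carrier G" using W_carrier by auto
  fix x assume "x \<in> W n"
  then have "\<forall>w\<in>W n. x \<oplus> w \<in> W n" using W_add by simp
  then show "\<exists>m. \<forall>w\<in>W m. x \<oplus> w \<in> W n" ..
qed

lemma neighbourhood_S: "neighbourhood S \<zero> Y \<longleftrightarrow> Y \<subseteq> carrier G \<and> (\<exists>n. W n \<subseteq> Y)"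
proof
  assume Y: "neighbourhood S \<zero> Y"
  then obtain U where U: "openin S U" "\<zero> \<in> U" "U \<subseteq> Y" unfolding neighbourhood_def by blast
  obtain n where n: "\<forall>w\<in>W n. \<zero> \<oplus> w \<in> U" using openin_SD[OF U(1,2)] ..
  then have "W n \<subseteq> Y" using U W_carrier by auto
  then show "Y \<subseteq> carrier G \<and> (\<exists>n. W n \<subseteq> Y)" using Y unfolding neighbourhood_def by auto
next
  assume "Y \<subseteq> carrier G \<and> (\<exists>n. W n \<subseteq> Y)"
  then obtain n where "Y \<subseteq> carrier G" "W n \<subseteq> Y" by blast
  then show "neighbourhood S \<zero> Y"
    using neighbourhood_mono[OF openin_imp_neighbourhood[OF openin_W W_zero]] by simp
qed

lemma topological_group_S: "topological_group (add_monoid G) S"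
  unfolding topological_group_def
proof (intro conjI)
  show "group (add_monoid G)" by (rule a_group)
  show "topspace S = carrier (add_monoid G)" by simp
  have "continuous_map (prod_topology S S) S (\<lambda>(x, y). x \<oplus> y)"
  proof (rule continuous_map_prodI)
    fix x y U assume A: "x \<in> topspace S" "y \<in> topspace S" "openin S U" "(case (x, y) of (x, y) \<Rightarrow> x \<oplus> y) \<in> U"
    then have xy: "x \<in> carrier G" "y \<in> carrier G" by simp_all
    obtain n where n: "\<forall>w\<in>W n. x \<oplus> y \<oplus> w \<in> U"
      using openin_SD[OF A(3,4)] by auto
    show "\<exists>A B. openin S A \<and> openin S B \<and> x \<in> A \<and> y \<in> B \<and>
        (\<forall>a\<in>A. \<forall>b\<in>B. (case (a, b) of (x, y) \<Rightarrow> x \<oplus> y) \<in> U)"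
    proof (intro exI conjI ballI)
      show "openin S ((\<lambda>w. x \<oplus> w) ` W n)" "openin S ((\<lambda>w. y \<oplus> w) ` W n)" using xy by (simp_all add: openin_coset)
      show "x \<in> (\<lambda>w. x \<oplus> w) ` W n" "y \<in> (\<lambda>w. y \<oplus> w) ` W n" using xy by (auto intro!: image_eqI[of _ _ \<zero>])
      fix a b assume "a \<in> (\<lambda>w. x \<oplus> w) ` W n" "b \<in> (\<lambda>w. y \<oplus> w) ` W n"
      then obtain v w where vw: "v \<in> W n" "w \<in> W n" "a = x \<oplus> v" "b = y \<oplus> w" by blast
      have "x \<oplus> y \<oplus> (v \<oplus> w) \<in> U" using n W_add vw by simp
      moreover have "a \<oplus> b = x \<oplus> y \<oplus> (v \<oplus> w)"
        using vw xy W_carrier[OF vw(1)] W_carrier[OF vw(2)] by (simp add: a_ac)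
      ultimately show "(case (a, b) of (x, y) \<Rightarrow> x \<oplus> y) \<in> U" by simp
    qed
  qed auto
  then show "continuous_map (prod_topology S S) S (\<lambda>(x, y). x \<otimes>\<^bsub>add_monoid G\<^esub> y)" by simp
  have "continuous_map S S (\<lambda>x. \<ominus> x)"
    unfolding continuous_map_def
  proof (intro conjI allI impI)
    fix U assume U: "openin S U"
    have "\<exists>n. \<forall>w\<in>W n. \<ominus> (x \<oplus> w) \<in> U" if x: "x \<in> carrier G" "\<ominus> x \<in> U" for x
    proof -
      obtain n where n: "\<forall>w\<in>W n. \<ominus> x \<oplus> w \<in> U" using openin_SD[OF U x(2)] ..
      have "\<ominus> (x \<oplus> w) \<in> U" if "w \<in> W n" for w
        using n W_uminus[OF that] x W_carrier[OF that] by (simp add: minus_add)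
      then show ?thesis by blast
    qed
    then show "openin S {x \<in> topspace S. \<ominus> x \<in> U}" unfolding openin_S using W_carrier by auto
  qed simp
  then show "continuous_map S S (\<lambda>x. inv\<^bsub>add_monoid G\<^esub> x)" by (simp add: a_inv_def)
qed

sublocale S: topological_abelian_group G S
  by unfold_locales (rule topological_group_S)

lemma countable_base_S:
  "\<exists>B. countable B \<and> (\<forall>U\<in>B. openin S U) \<and> fundamental_system S \<zero> B"
proof (intro exI conjI)
  show "countable (range W)" by simp
  show "\<forall>U\<in>range W. openin S U" using openin_W by blast
  have "W n \<subseteq> carrier G" for n using W_carrier by auto
  then show "fundamental_system S \<zero> (range W)"
    unfolding fundamental_system_def neighbourhood_S by auto
qed

lemma Hausdorff_S:
  assumes sep: "\<And>x. x \<in> carrier G \<Longrightarrow> (\<And>n. x \<in> W n) \<Longrightarrow> x = \<zero>"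
  shows "Hausdorff_space S"
  unfolding Hausdorff_space_def
proof (intro allI impI)
  fix x y assume A: "x \<in> topspace S \<and> y \<in> topspace S \<and> x \<noteq> y"
  then have xy: "x \<in> carrier G" "y \<in> carrier G" "y \<ominus> x \<noteq> \<zero>"
    using eq_of_diff_eq_zero[of y x] by auto
  then obtain n where n: "y \<ominus> x \<notin> W n" using sep[of "y \<ominus> x"] by auto
  show "\<exists>U V. openin S U \<and> openin S V \<and> x \<in> U \<and> y \<in> V \<and> disjnt U V"
  proof (intro exI conjI)
    show "openin S ((\<lambda>w. x \<oplus> w) ` W n)" "openin S ((\<lambda>w. y \<oplus> w) ` W n)" using xy by (simp_all add: openin_coset)
    show "x \<in> (\<lambda>w. x \<oplus> w) ` W n" "y \<in> (\<lambda>w. y \<oplus> w) ` W n" using xy by (auto intro!: image_eqI[of _ _ \<zero>])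
    have False if vw: "v \<in> W n" "w \<in> W n" "x \<oplus> v = y \<oplus> w" for v w
    proof -
      have c: "v \<in> carrier G" "w \<in> carrier G" using vw W_carrier by auto
      have "y \<ominus> x = (y \<oplus> w) \<ominus> x \<ominus> w" using xy c by (simp add: group_simps)
      also have "\<dots> = (x \<oplus> v) \<ominus> x \<ominus> w" by (simp only: vw(3))
      also have "\<dots> = v \<ominus> w" using xy c by (simp add: group_simps)
      finally show False using W_diff[OF vw(1,2)] n by simp
    qed
    then show "disjnt ((\<lambda>w. x \<oplus> w) ` W n) ((\<lambda>w. y \<oplus> w) ` W n)" unfolding disjnt_def by auto
  qed
qed

lemma complete_S:
  assumes lim: "\<And>x :: nat \<Rightarrow> 'a. \<lbrakk>\<And>i. x i \<in> carrier G; \<And>n. \<exists>N. \<forall>m\<ge>N. \<forall>k\<ge>N. x m \<ominus> x k \<in> W n\<rbrakk> \<Longrightarrow>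
      \<exists>l\<in>carrier G. \<forall>n. \<exists>N. \<forall>m\<ge>N. x m \<ominus> l \<in> W n"
  shows "complete_group (add_monoid G) S"
  unfolding S.complete_group_iff_nb
proof (intro allI impI, elim conjE)
  fix x :: "nat \<Rightarrow> 'a" assume x: "range x \<subseteq> carrier G"
    and C: "\<forall>Y. neighbourhood S \<zero> Y \<longrightarrow> (\<exists>N. \<forall>m\<ge>N. \<forall>k\<ge>N. x m \<ominus> x k \<in> Y)"
  have nbW: "neighbourhood S \<zero> (W n)" for n
    by (rule openin_imp_neighbourhood[OF openin_W W_zero])
  have xG: "x i \<in> carrier G" for i using x by auto
  have Cn: "\<exists>N. \<forall>m\<ge>N. \<forall>k\<ge>N. x m \<ominus> x k \<in> W n" for n
    by (rule C[rule_format, OF nbW])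
  have "\<exists>l\<in>carrier G. \<forall>n. \<exists>N. \<forall>m\<ge>N. x m \<ominus> l \<in> W n" by (rule lim[OF xG Cn])
  then obtain l where l: "l \<in> carrier G" "\<forall>n. \<exists>N. \<forall>m\<ge>N. x m \<ominus> l \<in> W n" by (elim bexE)
  have "\<exists>N. \<forall>n\<ge>N. x n \<in> carrier G \<and> x n \<ominus> l \<in> Y" if Y: "neighbourhood S \<zero> Y" for Y
  proof -
    obtain n where n: "W n \<subseteq> Y" using Y unfolding neighbourhood_S by blast
    obtain N where "\<forall>m\<ge>N. x m \<ominus> l \<in> W n" using l(2)[rule_format, of n] ..
    then show ?thesis using n xG by (intro exI[of _ N]) auto
  qed
  then have "limitin S x l sequentially" unfolding S.limitin_iff_nb using l(1) by simp
  then show "\<exists>l. limitin S x l sequentially" ..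
qed

end

text \<open>Expanding \<open>(r + v) (x + w)\<close> shows that continuity of the scalar multiplication at \<open>(r, x)\<close> amounts
  to continuity of \<open>w \<mapsto> r w\<close>, of \<open>v \<mapsto> v x\<close> and of the product at the origin.\<close>

lemma (in filtered_ring) topological_module_subgroup_topology:
  fixes M (structure)
  assumes M: "module R M" and W: "subgroup_filtration M W"
    and s1: "\<And>r n. r \<in> carrier R \<Longrightarrow> \<exists>m. \<forall>w\<in>W m. r \<odot>\<^bsub>M\<^esub> w \<in> W n"
    and s2: "\<And>x n. x \<in> carrier M \<Longrightarrow> \<exists>m. \<forall>v\<in>V m. v \<odot>\<^bsub>M\<^esub> x \<in> W n"
    and s3: "\<And>n. \<exists>m. \<forall>v\<in>V m. \<forall>w\<in>W m. v \<odot>\<^bsub>M\<^esub> w \<in> W n"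
  shows "topological_module R T M (subgroup_topology M W)"
proof -
  interpret M: module R M by fact
  interpret W: subgroup_filtration M W by fact
  have "continuous_map (prod_topology T W.S) W.S (\<lambda>(r, x). r \<odot>\<^bsub>M\<^esub> x)"
  proof (rule continuous_map_prodI)
    fix r x U assume A: "r \<in> topspace T" "x \<in> topspace W.S" "openin W.S U"
        "(case (r, x) of (r, x) \<Rightarrow> r \<odot>\<^bsub>M\<^esub> x) \<in> U"
    then have r: "r \<in> carrier R" and x: "x \<in> carrier M" by simp_all
    obtain n where n: "\<forall>w\<in>W n. r \<odot>\<^bsub>M\<^esub> x \<oplus>\<^bsub>M\<^esub> w \<in> U"
      using W.openin_SD[OF A(3,4)] by auto
    obtain m1 where m1: "\<forall>w\<in>W m1. r \<odot>\<^bsub>M\<^esub> w \<in> W n" using s1[OF r] ..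
    obtain m2 where m2: "\<forall>v\<in>V m2. v \<odot>\<^bsub>M\<^esub> x \<in> W n" using s2[OF x] ..
    obtain m3 where m3: "\<forall>v\<in>V m3. \<forall>w\<in>W m3. v \<odot>\<^bsub>M\<^esub> w \<in> W n" using s3 ..
    define m where "m = max m1 (max m2 m3)"
    have Vm: "V m \<subseteq> V m2" "V m \<subseteq> V m3" by (auto simp: m_def intro!: V_antimono)
    have Wm: "W m \<subseteq> W m1" "W m \<subseteq> W m3" by (auto simp: m_def intro!: W.W_antimono)
    have near: "(r \<oplus>\<^bsub>R\<^esub> v) \<odot>\<^bsub>M\<^esub> (x \<oplus>\<^bsub>M\<^esub> w) \<in> U" if v: "v \<in> V m" and w: "w \<in> W m" for v w
    proof -
      have c: "v \<in> carrier R" "w \<in> carrier M" using v w V_carrier W.W_carrier by auto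
      have "r \<odot>\<^bsub>M\<^esub> w \<oplus>\<^bsub>M\<^esub> (v \<odot>\<^bsub>M\<^esub> x \<oplus>\<^bsub>M\<^esub> v \<odot>\<^bsub>M\<^esub> w) \<in> W n"
      proof (intro W.W_add)
        show "r \<odot>\<^bsub>M\<^esub> w \<in> W n" using m1 w Wm by auto
        show "v \<odot>\<^bsub>M\<^esub> x \<in> W n" using m2 v Vm by auto
        have "v \<in> V m3" "w \<in> W m3" using v w Vm Wm by auto
        then show "v \<odot>\<^bsub>M\<^esub> w \<in> W n" using m3 by simp
      qed
      moreover have "(r \<oplus>\<^bsub>R\<^esub> v) \<odot>\<^bsub>M\<^esub> (x \<oplus>\<^bsub>M\<^esub> w) = r \<odot>\<^bsub>M\<^esub> x \<oplus>\<^bsub>M\<^esub> (r \<odot>\<^bsub>M\<^esub> w \<oplus>\<^bsub>M\<^esub> (v \<odot>\<^bsub>M\<^esub> x \<oplus>\<^bsub>M\<^esub> v \<odot>\<^bsub>M\<^esub> w))"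
        using r x c by (simp add: M.smult_l_distr M.smult_r_distr M.M.a_ac)
      ultimately show ?thesis using n by simp
    qed
    obtain O' where O': "openin T O'" "\<zero>\<^bsub>R\<^esub> \<in> O'" "O' \<subseteq> V m"
      using V_neighbourhood[of m] unfolding neighbourhood_def by blast
    show "\<exists>A B. openin T A \<and> openin W.S B \<and> r \<in> A \<and> x \<in> B \<and>
        (\<forall>a\<in>A. \<forall>b\<in>B. (case (a, b) of (r, x) \<Rightarrow> r \<odot>\<^bsub>M\<^esub> x) \<in> U)"
    proof (intro exI conjI ballI)
      show "openin T {a \<in> carrier R. \<ominus>\<^bsub>R\<^esub> r \<oplus>\<^bsub>R\<^esub> a \<in> O'}" using translate_open[OF _ O'(1)] r by simp
      show "r \<in> {a \<in> carrier R. \<ominus>\<^bsub>R\<^esub> r \<oplus>\<^bsub>R\<^esub> a \<in> O'}" using O' r by (simp add: l_neg)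
      show "openin W.S ((\<lambda>w. x \<oplus>\<^bsub>M\<^esub> w) ` W m)" using x by (rule W.openin_coset)
      show "x \<in> (\<lambda>w. x \<oplus>\<^bsub>M\<^esub> w) ` W m" using x by (auto intro!: image_eqI[of _ _ "\<zero>\<^bsub>M\<^esub>"])
      fix a b assume a: "a \<in> {a \<in> carrier R. \<ominus>\<^bsub>R\<^esub> r \<oplus>\<^bsub>R\<^esub> a \<in> O'}" and "b \<in> (\<lambda>w. x \<oplus>\<^bsub>M\<^esub> w) ` W m"
      then obtain w where w: "w \<in> W m" "b = x \<oplus>\<^bsub>M\<^esub> w" by blast
      have "(r \<oplus>\<^bsub>R\<^esub> (\<ominus>\<^bsub>R\<^esub> r \<oplus>\<^bsub>R\<^esub> a)) \<odot>\<^bsub>M\<^esub> (x \<oplus>\<^bsub>M\<^esub> w) \<in> U" using a O' w by (intro near) auto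
      then show "(case (a, b) of (r, x) \<Rightarrow> r \<odot>\<^bsub>M\<^esub> x) \<in> U" using a r w by (simp add: r_neg2)
    qed
  qed auto
  then show ?thesis
    unfolding topological_module_def using M topological_ring W.topological_group_S by simp
qed

section \<open>The topology of a finitely generated module\<close>

locale finitely_generated_filtered_module = module R M + filtered_ring R T V
  for R (structure) and T V and M (structure) +
  fixes E
  assumes E_finite: "finite E" and E_carrier: "E \<subseteq> carrier M"
    and gen: "lincombs M E (carrier R) = carrier M"
begin

abbreviation "W n \<equiv> lincombs M E (V n)"

lemma V_coeffs: "c \<in> E \<rightarrow> V n \<Longrightarrow> c \<in> E \<rightarrow> carrier R"
  using V_carrier[of _ n] by (simp add: Pi_iff)

lemma in_lincombsI: "c \<in> E \<rightarrow> C \<Longrightarrow> lincomb M E c \<in> lincombs M E C"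
  unfolding lincombs_def by (rule imageI)

lemma in_lincombsE:
  assumes "x \<in> lincombs M E C"
  obtains c where "c \<in> E \<rightarrow> C" "x = lincomb M E c"
  using assms unfolding lincombs_def by (elim imageE)

lemma W_filtration: "subgroup_filtration M W"
proof (intro subgroup_filtration.intro subgroup_filtration_axioms.intro)
  show "abelian_group M" by (rule M.abelian_group_axioms)
  fix n
  show "W (Suc n) \<subseteq> W n" unfolding lincombs_def using V_Suc[of n] by (auto intro!: imageI)
  show "subgroup (W n) (add_monoid M)"
  proof (rule group.subgroupI[OF M.a_group])
    have "V n \<subseteq> carrier R" using V_carrier by auto
    then show "W n \<subseteq> carrier (add_monoid M)" using lincombs_carrier[OF E_carrier] by simp
    show "W n \<noteq> {}" using in_lincombsI[of "\<lambda>_. \<zero>" "V n"] by auto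
  next
    fix x assume "x \<in> W n"
    then obtain c where c: "c \<in> E \<rightarrow> V n" "x = lincomb M E c" by (rule in_lincombsE)
    then have "\<ominus>\<^bsub>M\<^esub> x = lincomb M E (\<lambda>e. \<ominus> c e)"
      using lincomb_uminus[OF E_carrier E_finite V_coeffs] by simp
    moreover have "(\<lambda>e. \<ominus> c e) \<in> E \<rightarrow> V n" using c by (auto intro: V_uminus)
    ultimately show "inv\<^bsub>add_monoid M\<^esub> x \<in> W n" using in_lincombsI by (simp add: a_inv_def)
    fix y assume "y \<in> W n"
    then obtain d where d: "d \<in> E \<rightarrow> V n" "y = lincomb M E d" by (rule in_lincombsE)
    have "x \<oplus>\<^bsub>M\<^esub> y = lincomb M E (\<lambda>e. c e \<oplus> d e)"
      using lincomb_add[OF E_carrier V_coeffs V_coeffs] c d by simp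
    moreover have "(\<lambda>e. c e \<oplus> d e) \<in> E \<rightarrow> V n" using c d by (auto intro: V_add)
    ultimately show "x \<otimes>\<^bsub>add_monoid M\<^esub> y \<in> W n" using in_lincombsI by simp
  qed
qed

sublocale W: subgroup_filtration M W by (rule W_filtration)

lemma W_topological_module: "topological_module R T M (subgroup_topology M W)"
proof (rule topological_module_subgroup_topology[OF module_axioms W_filtration])
  fix r n assume r: "r \<in> carrier R"
  obtain m where m: "\<forall>v\<in>V m. r \<otimes> v \<in> V n" using mult_small_left[OF r] ..
  have "r \<odot>\<^bsub>M\<^esub> w \<in> W n" if "w \<in> W m" for w
  proof -
    obtain c where c: "c \<in> E \<rightarrow> V m" "w = lincomb M E c" using \<open>w \<in> W m\<close> by (rule in_lincombsE)
    then have "r \<odot>\<^bsub>M\<^esub> w = lincomb M E (\<lambda>e. r \<otimes> c e)"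
      using lincomb_smult[OF E_carrier E_finite V_coeffs r] by simp
    moreover have "(\<lambda>e. r \<otimes> c e) \<in> E \<rightarrow> V n" using c m by auto
    ultimately show ?thesis using in_lincombsI by simp
  qed
  then show "\<exists>m. \<forall>w\<in>W m. r \<odot>\<^bsub>M\<^esub> w \<in> W n" by (intro exI[of _ m] ballI)
next
  fix x n assume "x \<in> carrier M"
  then obtain c where c: "c \<in> E \<rightarrow> carrier R" "x = lincomb M E c" unfolding gen[symmetric] by (rule in_lincombsE)
  obtain m where m: "\<forall>e\<in>E. \<forall>v\<in>V m. v \<otimes> c e \<in> V n" using mult_small_finite[OF E_finite c(1)] ..
  have "v \<odot>\<^bsub>M\<^esub> x \<in> W n" if "v \<in> V m" for v
  proof -
    have "v \<odot>\<^bsub>M\<^esub> x = lincomb M E (\<lambda>e. v \<otimes> c e)"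
      using lincomb_smult[OF E_carrier E_finite c(1) V_carrier[OF that]] c(2) by simp
    moreover have "(\<lambda>e. v \<otimes> c e) \<in> E \<rightarrow> V n" using m that by auto
    ultimately show ?thesis using in_lincombsI by simp
  qed
  then show "\<exists>m. \<forall>v\<in>V m. v \<odot>\<^bsub>M\<^esub> x \<in> W n" by (intro exI[of _ m] ballI)
next
  fix n
  obtain m where m: "\<forall>v\<in>V m. \<forall>w\<in>V m. v \<otimes> w \<in> V n" using mult_small ..
  have "v \<odot>\<^bsub>M\<^esub> w \<in> W n" if v: "v \<in> V m" and w: "w \<in> W m" for v w
  proof -
    obtain c where c: "c \<in> E \<rightarrow> V m" "w = lincomb M E c" using w by (rule in_lincombsE)
    then have "v \<odot>\<^bsub>M\<^esub> w = lincomb M E (\<lambda>e. v \<otimes> c e)"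
      using lincomb_smult[OF E_carrier E_finite V_coeffs V_carrier[OF v]] by simp
    moreover have "(\<lambda>e. v \<otimes> c e) \<in> E \<rightarrow> V n" using c m v by auto
    ultimately show ?thesis using in_lincombsI by simp
  qed
  then show "\<exists>m. \<forall>v\<in>V m. \<forall>w\<in>W m. v \<odot>\<^bsub>M\<^esub> w \<in> W n" by (intro exI[of _ m] ballI)
qed

text \<open>Along a subsequence \<open>x (N n)\<close> the steps lie in \<open>W n\<close> and so have coefficients \<open>d n\<close> in \<open>V n\<close>. The
  partial sums \<open>s n\<close> of these coefficients converge in \<open>R\<close>, and the combination of \<open>E\<close> with the limit
  coefficients is the limit of \<open>x (N n) - x (N 0)\<close>.\<close>

lemma W_complete: "complete_group (add_monoid M) (subgroup_topology M W)"
proof (rule W.complete_S)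
  fix x :: "nat \<Rightarrow> 'c"
  assume x: "\<And>i. x i \<in> carrier M" and cauchy: "\<And>n. \<exists>N. \<forall>m\<ge>N. \<forall>k\<ge>N. x m \<ominus>\<^bsub>M\<^esub> x k \<in> W n"
  obtain N' where N': "\<And>n m k. \<lbrakk>m \<ge> N' n; k \<ge> N' n\<rbrakk> \<Longrightarrow> x m \<ominus>\<^bsub>M\<^esub> x k \<in> W n"
    using choice[OF allI, of "\<lambda>n N. \<forall>m\<ge>N. \<forall>k\<ge>N. x m \<ominus>\<^bsub>M\<^esub> x k \<in> W n", OF cauchy] by auto
  \<comment> \<open>Partial sums turn the moduli of convergence into a monotone sequence.\<close>
  define N where "N n = (\<Sum>i\<le>n. N' i)" for n
  have N_ge: "N' n \<le> N n" for n unfolding N_def by (rule member_le_sum) auto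
  have N_Suc: "N n \<le> N (Suc n)" for n unfolding N_def by simp
  have near: "x m \<ominus>\<^bsub>M\<^esub> x k \<in> W n" if "m \<ge> N n" "k \<ge> N n" for m k n
    using N' that N_ge le_trans by blast
  have "\<exists>d. d \<in> E \<rightarrow> V n \<and> x (N (Suc n)) \<ominus>\<^bsub>M\<^esub> x (N n) = lincomb M E d" for n
    by (rule in_lincombsE[OF near[OF N_Suc order_refl]]) blast
  then obtain d where d: "\<And>n. d n \<in> E \<rightarrow> V n"
      "\<And>n. x (N (Suc n)) \<ominus>\<^bsub>M\<^esub> x (N n) = lincomb M E (d n)"
    by metis
  define s where "s = rec_nat (\<lambda>_. \<zero>) (\<lambda>n p e. p e \<oplus> d n e)"
  have s_0: "s 0 = (\<lambda>_. \<zero>)" and s_Suc: "s (Suc n) = (\<lambda>e. s n e \<oplus> d n e)" for n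
    by (simp_all add: s_def)
  have dR: "d n \<in> E \<rightarrow> carrier R" for n by (rule V_coeffs[OF d(1)])
  have sR: "s n \<in> E \<rightarrow> carrier R" for n
    by (induction n) (use dR in \<open>auto simp: s_0 s_Suc\<close>)
  have s: "lincomb M E (s n) = x (N n) \<ominus>\<^bsub>M\<^esub> x (N 0)" for n
  proof (induction n)
    case 0
    show ?case using x by (simp add: s_0 lincomb_zero[OF E_carrier] M.group_simps)
  next
    case (Suc n)
    show ?case
      unfolding s_Suc lincomb_add[OF E_carrier sR dR] Suc d(2)[symmetric]
      using x by (simp add: M.group_simps)
  qed
  have "\<exists>c\<in>carrier R. \<forall>k. c \<ominus> s k e \<in> V (0 + k)" if e: "e \<in> E" for e
  proof (rule limit_near_steps)
    show "s k e \<in> carrier R" for k using sR e by auto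
    have "d k e \<in> carrier R" "d k e \<in> V k" for k using dR d(1) e by auto
    then show "s (Suc k) e \<ominus> s k e \<in> V (0 + k)" for k
      using \<open>s k e \<in> carrier R\<close> by (simp add: s_Suc R.group_simps)
  qed
  then obtain c where c: "\<And>e. e \<in> E \<Longrightarrow> c e \<in> carrier R" "\<And>e k. e \<in> E \<Longrightarrow> c e \<ominus> s k e \<in> V k"
    by (metis add_0)
  have cR: "c \<in> E \<rightarrow> carrier R" using c(1) by simp
  define l where "l = x (N 0) \<oplus>\<^bsub>M\<^esub> lincomb M E c"
  have lc: "lincomb M E c \<in> carrier M" using lincomb_closed[OF E_carrier cR] .
  have "x m \<ominus>\<^bsub>M\<^esub> l \<in> W n" if "m \<ge> N n" for m n
  proof -
    let ?r = "lincomb M E (\<lambda>e. c e \<ominus> s n e)"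
    have "?r \<in> W n" using c(2) by (intro in_lincombsI) simp
    then have "(x m \<ominus>\<^bsub>M\<^esub> x (N n)) \<ominus>\<^bsub>M\<^esub> ?r \<in> W n"
      by (rule W.W_diff[OF near[OF that order_refl]])
    also have "?r = lincomb M E c \<ominus>\<^bsub>M\<^esub> (x (N n) \<ominus>\<^bsub>M\<^esub> x (N 0))"
      using lincomb_diff[OF E_carrier E_finite cR sR] s by simp
    also have "(x m \<ominus>\<^bsub>M\<^esub> x (N n)) \<ominus>\<^bsub>M\<^esub> (lincomb M E c \<ominus>\<^bsub>M\<^esub> (x (N n) \<ominus>\<^bsub>M\<^esub> x (N 0))) = x m \<ominus>\<^bsub>M\<^esub> l"
      unfolding l_def using x lc by (simp add: M.group_simps)
    finally show ?thesis .
  qed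
  then show "\<exists>l\<in>carrier M. \<forall>n. \<exists>N. \<forall>m\<ge>N. x m \<ominus>\<^bsub>M\<^esub> l \<in> W n"
    using x lc unfolding l_def by (intro bexI[of _ "x (N 0) \<oplus>\<^bsub>M\<^esub> lincomb M E c"] allI) auto
qed

lemma eq_W_topology:
  assumes "complete_filtered_ring_module R T V M S u"
  shows "S = subgroup_topology M W"
proof -
  interpret S: complete_filtered_ring_module R T V M S u by fact
  show ?thesis
  proof (rule topological_group_eqI[of M])
    show "topological_abelian_group M S" by unfold_locales
    show "topological_abelian_group M (subgroup_topology M W)" by unfold_locales
    fix Y
    show "neighbourhood S \<zero>\<^bsub>M\<^esub> Y \<longleftrightarrow> neighbourhood (subgroup_topology M W) \<zero>\<^bsub>M\<^esub> Y"
      unfolding W.neighbourhood_S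
    proof
      assume Y: "neighbourhood S \<zero>\<^bsub>M\<^esub> Y"
      then show "Y \<subseteq> carrier M \<and> (\<exists>n. W n \<subseteq> Y)"
        using S.S.nb_subset[OF Y] S.nb_lincombs[OF E_finite E_carrier Y] by simp
    next
      assume "Y \<subseteq> carrier M \<and> (\<exists>n. W n \<subseteq> Y)"
      then obtain n where "Y \<subseteq> carrier M" "W n \<subseteq> Y" by (elim conjE exE)
      then show "neighbourhood S \<zero>\<^bsub>M\<^esub> Y"
        using neighbourhood_mono[OF S.lincombs_nb[OF E_finite E_carrier gen]] by simp
    qed
  qed
qed

end

section \<open>Submodules of a finite free module over a noetherian ring\<close>

text \<open>The finite free module \<open>R^A\<close>, realised by functions that are \<open>undefined\<close> outside \<open>A\<close> so that
  equality is equality on \<open>A\<close>. Module records extend ring records, so a product and a unit have to be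
  supplied; their values are arbitrary.\<close>

definition function_module :: "('a, 'm) ring_scheme \<Rightarrow> 'b set \<Rightarrow> ('a, 'b \<Rightarrow> 'a) module" where
  "function_module R A =
    \<lparr>carrier = A \<rightarrow>\<^sub>E carrier R, mult = undefined, one = undefined,
     zero = (\<lambda>a\<in>A. \<zero>\<^bsub>R\<^esub>), add = (\<lambda>f g. \<lambda>a\<in>A. f a \<oplus>\<^bsub>R\<^esub> g a),
     smult = (\<lambda>r f. \<lambda>a\<in>A. r \<otimes>\<^bsub>R\<^esub> f a)\<rparr>"

context cring begin

lemma function_module_simps [simp]:
  "carrier (function_module R A) = A \<rightarrow>\<^sub>E carrier R"
  "\<zero>\<^bsub>function_module R A\<^esub> = (\<lambda>a\<in>A. \<zero>)"
  "f \<oplus>\<^bsub>function_module R A\<^esub> g = (\<lambda>a\<in>A. f a \<oplus> g a)"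
  "r \<odot>\<^bsub>function_module R A\<^esub> f = (\<lambda>a\<in>A. r \<otimes> f a)"
  by (simp_all add: function_module_def)

lemma module_function_module: "module R (function_module R A)"
proof (rule moduleI)
  let ?F = "function_module R A"
  show "cring R" by (rule is_cring)
  show "abelian_group ?F"
  proof (rule abelian_groupI)
    fix f assume f: "f \<in> carrier ?F"
    then show "\<zero>\<^bsub>?F\<^esub> \<oplus>\<^bsub>?F\<^esub> f = f" by (auto intro!: ext simp: PiE_iff extensional_def)
    show "\<exists>g\<in>carrier ?F. g \<oplus>\<^bsub>?F\<^esub> f = \<zero>\<^bsub>?F\<^esub>"
      using f by (intro bexI[of _ "\<lambda>a\<in>A. \<ominus> f a"]) (auto intro!: ext simp: PiE_iff l_neg)
  qed (auto intro!: ext simp: PiE_iff a_ac)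
qed (auto intro!: ext simp: PiE_iff extensional_def l_distr r_distr m_assoc)

lemma function_module_uminus:
  assumes "f \<in> A \<rightarrow>\<^sub>E carrier R"
  shows "\<ominus>\<^bsub>function_module R A\<^esub> f = (\<lambda>a\<in>A. \<ominus> f a)"
proof -
  interpret F: module R "function_module R A" by (rule module_function_module)
  have "(\<lambda>a\<in>A. \<ominus> f a) \<oplus>\<^bsub>function_module R A\<^esub> f = \<zero>\<^bsub>function_module R A\<^esub>"
    using assms by (auto intro!: ext simp: PiE_iff l_neg)
  then show ?thesis
    using assms by (intro F.M.minus_equality) (auto simp: PiE_iff)
qed

lemma function_module_diff:
  assumes "f \<in> A \<rightarrow>\<^sub>E carrier R" "g \<in> A \<rightarrow>\<^sub>E carrier R"
  shows "f \<ominus>\<^bsub>function_module R A\<^esub> g = (\<lambda>a\<in>A. f a \<ominus> g a)"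
  using assms by (auto intro!: ext simp: a_minus_def[of "function_module R A"] function_module_uminus minus_eq)

end

text \<open>Generation without reference to linear combinations: \<open>L\<close> is the least submodule containing \<open>E\<close>.
  In this form a statement about submodules of \<open>N \<subseteq> R^A\<close> is a statement about submodules of \<open>R^A\<close>.\<close>

definition generates :: "('a, 'm) ring_scheme \<Rightarrow> ('a, 'b, 'n) module_scheme \<Rightarrow> 'b set \<Rightarrow> 'b set \<Rightarrow> bool" where
  "generates R M E L \<longleftrightarrow> E \<subseteq> L \<and> (\<forall>P. submodule P R M \<longrightarrow> E \<subseteq> P \<longrightarrow> L \<subseteq> P)"

lemma (in module) submodule_diff:
  assumes "submodule P R M" "x \<in> P" "y \<in> P"
  shows "x \<ominus>\<^bsub>M\<^esub> y \<in> P"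
  using submoduleE(3,5)[OF assms(1)] assms(2,3) by (simp add: M.minus_eq)

text \<open>Induction on the set \<open>B\<close> of coordinates in which elements of \<open>L\<close> may be nonzero. For
  \<open>B \<union> {b}\<close>, the \<open>b\<close>-coordinates of \<open>L\<close> form a finitely generated ideal; lifts of its generators together
  with generators of \<open>{f \<in> L. f b = 0}\<close> generate \<open>L\<close>.\<close>

lemma noetherian_function_module:
  fixes R (structure)
  assumes "noetherian_ring R" "cring R" "finite A" "submodule L R (function_module R A)"
  shows "\<exists>E. finite E \<and> generates R (function_module R A) E L"
proof -
  interpret cring R by fact
  interpret noetherian_ring R by fact
  let ?F = "function_module R A"
  interpret F: module R ?F by (rule module_function_module)
  have "\<exists>E. finite E \<and> generates R ?F E L"
    if "finite B" "B \<subseteq> A" "submodule L R ?F" "\<forall>f\<in>L. \<forall>a\<in>A - B. f a = \<zero>" for B L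
    using that
  proof (induction B arbitrary: L rule: finite_induct)
    case empty
    have "f = \<zero>\<^bsub>?F\<^esub>" if "f \<in> L" for f
      using F.submoduleE(1)[OF empty(2)] that empty(3) by (auto intro!: ext simp: PiE_iff extensional_def)
    then have "L \<subseteq> P" if "submodule P R ?F" for P
      using subgroup.one_closed[OF submodule.axioms(1)[OF that]] by auto
    then show ?case unfolding generates_def by (intro exI[of _ "{}"]) auto
  next
    case (insert b B)
    have bA: "b \<in> A" "B \<subseteq> A" using insert by auto
    have LF: "f \<in> A \<rightarrow>\<^sub>E carrier R" if "f \<in> L" for f using F.submoduleE(1)[OF insert(5)] that by auto
    have ideal_coords: "ideal ((\<lambda>f. f b) ` P) R" if P: "submodule P R ?F" for P
    proof -
      have PF: "f \<in> A \<rightarrow>\<^sub>E carrier R" if "f \<in> P" for f using F.submoduleE(1)[OF P] that by auto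
      have uminus: "(\<lambda>a\<in>A. \<ominus> f a) \<in> P" if "f \<in> P" for f
        using F.submoduleE(3)[OF P that] function_module_uminus[OF PF[OF that]] by simp
      have zero: "\<zero>\<^bsub>?F\<^esub> \<in> P" using subgroup.one_closed[OF submodule.axioms(1)[OF P]] by simp
      have add: "(\<lambda>a\<in>A. f a \<oplus> g a) \<in> P" if "f \<in> P" "g \<in> P" for f g
        using F.submoduleE(5)[OF P that] by simp
      have smult: "(\<lambda>a\<in>A. r \<otimes> f a) \<in> P" if "r \<in> carrier R" "f \<in> P" for r f
        using F.submoduleE(4)[OF P that] by simp
      show ?thesis
      proof (rule idealI)
        show "subgroup ((\<lambda>f. f b) ` P) (add_monoid R)"
        proof (rule group.subgroupI[OF a_group])
          show "(\<lambda>f. f b) ` P \<subseteq> carrier (add_monoid R)" using PF bA by (auto simp: PiE_iff)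
          show "(\<lambda>f. f b) ` P \<noteq> {}" using zero by blast
        next
          fix x assume "x \<in> (\<lambda>f. f b) ` P"
          then obtain f where f: "f \<in> P" "x = f b" by blast
          show "inv\<^bsub>add_monoid R\<^esub> x \<in> (\<lambda>f. f b) ` P"
            using uminus[OF f(1)] bA f by (intro image_eqI[of _ _ "\<lambda>a\<in>A. \<ominus> f a"]) (auto simp: a_inv_def)
          fix y assume "y \<in> (\<lambda>f. f b) ` P"
          then obtain g where g: "g \<in> P" "y = g b" by blast
          show "x \<otimes>\<^bsub>add_monoid R\<^esub> y \<in> (\<lambda>f. f b) ` P"
            using add[OF f(1) g(1)] bA f g by (intro image_eqI[of _ _ "\<lambda>a\<in>A. f a \<oplus> g a"]) auto
        qed
      next
        fix x r assume "x \<in> (\<lambda>f. f b) ` P" and r: "r \<in> carrier R"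
        then obtain f where f: "f \<in> P" "x = f b" by blast
        then have x: "x \<in> carrier R" using PF bA by (auto simp: PiE_iff)
        show *: "r \<otimes> x \<in> (\<lambda>f. f b) ` P"
          using smult[OF r f(1)] bA f by (intro image_eqI[of _ _ "\<lambda>a\<in>A. r \<otimes> f a"]) auto
        then show "x \<otimes> r \<in> (\<lambda>f. f b) ` P" using x r by (simp add: m_comm)
      qed (rule ring_axioms)
    qed
    obtain C where C: "C \<subseteq> carrier R" "finite C" "(\<lambda>f. f b) ` L = Idl C"
      using finetely_gen[OF ideal_coords[OF insert(5)]] by blast
    have "C \<subseteq> (\<lambda>f. f b) ` L" unfolding C(3) by (rule genideal_self[OF C(1)])
    then obtain D where D: "D \<subseteq> L" "finite D" "C = (\<lambda>f. f b) ` D"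
      using finite_subset_image[OF C(2)] by blast
    define L' where "L' = {f \<in> L. f b = \<zero>}"
    have sub': "submodule L' R ?F"
    proof (rule F.submoduleI)
      show "L' \<subseteq> carrier ?F" using F.submoduleE(1)[OF insert(5)] unfolding L'_def by blast
      show "\<zero>\<^bsub>?F\<^esub> \<in> L'"
        using subgroup.one_closed[OF submodule.axioms(1)[OF insert(5)]] bA unfolding L'_def by simp
    next
      fix f assume f: "f \<in> L'"
      then show "\<ominus>\<^bsub>?F\<^esub> f \<in> L'"
        using F.submoduleE(3)[OF insert(5), of f] function_module_uminus[OF LF, of f] bA
        unfolding L'_def by simp
      fix r assume "r \<in> carrier R"
      then show "r \<odot>\<^bsub>?F\<^esub> f \<in> L'"
        using F.submoduleE(4)[OF insert(5), of r f] f bA unfolding L'_def by simp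
    next
      fix f g assume "f \<in> L'" "g \<in> L'"
      then show "f \<oplus>\<^bsub>?F\<^esub> g \<in> L'"
        using F.submoduleE(5)[OF insert(5), of f g] bA unfolding L'_def by simp
    qed
    have "\<forall>f\<in>L'. \<forall>a\<in>A - B. f a = \<zero>" using insert(6) unfolding L'_def by auto
    then obtain E where E: "finite E" "generates R ?F E L'" using insert.IH[OF bA(2) sub'] by blast
    have "L \<subseteq> P" if P: "submodule P R ?F" and ED: "E \<union> D \<subseteq> P" for P
    proof
      fix f assume f: "f \<in> L"
      have L'P: "L' \<subseteq> P" using E(2) P ED unfolding generates_def by blast
      have int: "submodule (P \<inter> L) R ?F"
        using F.submoduleE[OF P] F.submoduleE[OF insert(5)]
          subgroup.one_closed[OF submodule.axioms(1)[OF P]] subgroup.one_closed[OF submodule.axioms(1)[OF insert(5)]]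
        by (intro F.submoduleI) auto
      have "C \<subseteq> (\<lambda>f. f b) ` (P \<inter> L)" using D ED by blast
      then have "Idl C \<subseteq> (\<lambda>f. f b) ` (P \<inter> L)" by (rule genideal_minimal[OF ideal_coords[OF int]])
      then obtain g where g: "g \<in> P" "g \<in> L" "f b = g b" using f C(3) by blast
      have "f \<ominus>\<^bsub>?F\<^esub> g \<in> L" using F.submodule_diff[OF insert(5) f g(2)] .
      moreover have "(f \<ominus>\<^bsub>?F\<^esub> g) b = \<zero>"
        using function_module_diff[OF LF[OF f] LF[OF g(2)]] g(3) bA LF[OF g(2)] by (auto simp: PiE_iff)
      ultimately have "f \<ominus>\<^bsub>?F\<^esub> g \<in> P" using L'P unfolding L'_def by blast
      then have "(f \<ominus>\<^bsub>?F\<^esub> g) \<oplus>\<^bsub>?F\<^esub> g \<in> P" using g(1) by (rule F.submoduleE(5)[OF P])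
      moreover have "(f \<ominus>\<^bsub>?F\<^esub> g) \<oplus>\<^bsub>?F\<^esub> g = f"
        using subsetD[OF F.submoduleE(1)[OF insert(5)] f] subsetD[OF F.submoduleE(1)[OF insert(5)] g(2)]
        by (simp only: F.M.group_simps F.M.a_inv_closed F.M.r_zero)
      ultimately show "f \<in> P" by simp
    qed
    moreover have "E \<union> D \<subseteq> L" using E(2) D(1) unfolding generates_def L'_def by blast
    ultimately show ?case using E(1) D(2) unfolding generates_def by (intro exI[of _ "E \<union> D"]) auto
  qed
  from this[of A L] show ?thesis using assms by simp
qed

section \<open>Dense submodules of complete noetherian modules\<close>

lemma (in module) submodule_Inter:
  assumes "\<And>P. P \<in> \<P> \<Longrightarrow> submodule P R M" "\<P> \<noteq> {}"
  shows "submodule (\<Inter>\<P>) R M"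
proof -
  have zero: "\<zero>\<^bsub>M\<^esub> \<in> P" if "P \<in> \<P>" for P
    using subgroup.one_closed[OF submodule.axioms(1)[OF assms(1)[OF that]]] by simp
  show ?thesis
  proof (rule submoduleI)
    obtain P where "P \<in> \<P>" using assms(2) by blast
    then show "\<Inter>\<P> \<subseteq> carrier M" using submoduleE(1)[OF assms(1)] by blast
    show "\<zero>\<^bsub>M\<^esub> \<in> \<Inter>\<P>" using zero by blast
  qed (use submoduleE(3-5)[OF assms(1)] in \<open>auto\<close>)
qed

lemma (in module) generates_imp_lincombs:
  assumes "finite E" "generates R M E (carrier M)"
  shows "lincombs M E (carrier R) = carrier M"
proof -
  have E: "E \<subseteq> carrier M" using assms(2) unfolding generates_def by simp
  have "carrier M \<subseteq> lincombs M E (carrier R)"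
    using assms(2) submodule_lincombs[OF E assms(1)] unfolding generates_def by blast
  then show ?thesis using lincombs_carrier[OF E, of "carrier R"] by blast
qed

context complete_filtered_ring_module begin

text \<open>By density \<open>e - l\<close> is, for some \<open>l\<close> in \<open>L\<close>, a combination of \<open>E \<union> {e}\<close> with coefficients in \<open>V n\<close>. Its
  coefficient \<open>c e\<close> at \<open>e\<close> is topologically nilpotent and the remaining part is in \<open>L\<close>, so \<open>L\<close> contains
  \<open>(1 - c e) e\<close> and, \<open>1 - c e\<close> being a unit, also \<open>e\<close>. Since one
  element is treated at a time, only a scalar has to be inverted and not a matrix over \<open>R\<close>.\<close>

lemma adjoin_element:
  assumes nil: "V n \<subseteq> {r \<in> carrier R. topologically_nilpotent R T r}"
    and L: "submodule L R M" and E: "finite E" "generates R M E L"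
    and dense: "\<And>x Y. x \<in> carrier M \<Longrightarrow> S.nb Y \<Longrightarrow> \<exists>l\<in>L. x \<ominus>\<^bsub>M\<^esub> l \<in> Y"
    and e: "e \<in> carrier M" and gen: "\<And>P. submodule P R M \<Longrightarrow> insert e L \<subseteq> P \<Longrightarrow> carrier M \<subseteq> P"
  shows "e \<in> L"
proof (rule ccontr)
  assume eL: "e \<notin> L"
  have LM: "L \<subseteq> carrier M" by (rule submoduleE(1)[OF L])
  have EL: "E \<subseteq> L" using E(2) unfolding generates_def by simp
  have EM: "E \<subseteq> carrier M" using EL LM by simp
  have E': "finite (insert e E)" "insert e E \<subseteq> carrier M" using E EM e by auto
  have "carrier M \<subseteq> P" if "submodule P R M" "insert e E \<subseteq> P" for P
    using gen[OF that(1)] E(2) that unfolding generates_def by blast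
  then have "generates R M (insert e E) (carrier M)" using E' unfolding generates_def by simp
  then have "lincombs M (insert e E) (carrier R) = carrier M" by (rule generates_imp_lincombs[OF E'(1)])
  then have "S.nb (lincombs M (insert e E) (V n))" by (rule lincombs_nb[OF E'])
  then obtain l where l: "l \<in> L" "e \<ominus>\<^bsub>M\<^esub> l \<in> lincombs M (insert e E) (V n)"
    using dense[OF e] by blast
  then obtain c where c: "c \<in> insert e E \<rightarrow> V n" "e \<ominus>\<^bsub>M\<^esub> l = lincomb M (insert e E) c"
    unfolding lincombs_def by blast
  have cR: "c \<in> insert e E \<rightarrow> carrier R" using c(1) V_carrier[of _ n] by (simp add: Pi_iff)
  have ce: "c e \<in> carrier R" "c e \<in> V n" using c(1) cR by auto
  have "e \<notin> E" using EL eL by blast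
  then have split: "e \<ominus>\<^bsub>M\<^esub> l = c e \<odot>\<^bsub>M\<^esub> e \<oplus>\<^bsub>M\<^esub> lincomb M E c"
    unfolding c(2) by (intro lincomb_insert[OF EM E(1) e _ cR])
  have rest: "lincomb M E c \<in> L" using submodule_lincomb_closed[OF EM E(1) L EL] cR by auto
  have lM: "l \<in> carrier M" "lincomb M E c \<in> carrier M" using l(1) rest LM by auto
  have ceM: "c e \<odot>\<^bsub>M\<^esub> e \<in> carrier M" using ce e by simp
  let ?v = "\<one> \<ominus> c e"
  have unit: "?v \<in> Units R" using one_minus_nilpotent_unit nil ce by blast
  have vR: "?v \<in> carrier R" using ce by simp
  have "?v \<odot>\<^bsub>M\<^esub> e = e \<ominus>\<^bsub>M\<^esub> c e \<odot>\<^bsub>M\<^esub> e"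
    using ce e by (simp add: R.minus_eq M.minus_eq smult_l_distr smult_l_minus)
  also have "\<dots> = (e \<ominus>\<^bsub>M\<^esub> l) \<oplus>\<^bsub>M\<^esub> l \<ominus>\<^bsub>M\<^esub> c e \<odot>\<^bsub>M\<^esub> e"
    using e lM ceM by (simp add: M.group_simps)
  also have "\<dots> = lincomb M E c \<oplus>\<^bsub>M\<^esub> l"
    unfolding split using e lM ceM by (simp add: M.group_simps)
  finally have "?v \<odot>\<^bsub>M\<^esub> e \<in> L" using submoduleE(5)[OF L rest l(1)] by simp
  then have "inv ?v \<odot>\<^bsub>M\<^esub> (?v \<odot>\<^bsub>M\<^esub> e) \<in> L"
    by (rule submoduleE(4)[OF L Units_inv_closed[OF unit]])
  also have "inv ?v \<odot>\<^bsub>M\<^esub> (?v \<odot>\<^bsub>M\<^esub> e) = e"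
    using Units_inv_closed[OF unit] vR e Units_l_inv[OF unit] by (simp add: smult_assoc1[symmetric])
  finally show False using eL by simp
qed

text \<open>Induction on a finite set \<open>E\<close> that generates the module together with \<open>L\<close>: an element of \<open>E\<close> that is
  left out is recovered by \<open>adjoin_element\<close>, applied to the submodule \<open>L'\<close> generated by \<open>L\<close> and the rest
  of \<open>E\<close>.\<close>

lemma dense_submodule_eq:
  assumes nil: "V n \<subseteq> {r \<in> carrier R. topologically_nilpotent R T r}"
    and noeth: "\<And>L. submodule L R M \<Longrightarrow> \<exists>E. finite E \<and> generates R M E L"
    and K: "submodule K R M"
    and dense: "\<And>x Y. x \<in> carrier M \<Longrightarrow> S.nb Y \<Longrightarrow> \<exists>k\<in>K. x \<ominus>\<^bsub>M\<^esub> k \<in> Y"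
  shows "K = carrier M"
proof -
  have claim: "carrier M \<subseteq> L"
    if "finite E" "E \<subseteq> carrier M" "submodule L R M" "K \<subseteq> L"
      "\<And>P. submodule P R M \<Longrightarrow> L \<union> E \<subseteq> P \<Longrightarrow> carrier M \<subseteq> P" for E L
    using that
  proof (induction E rule: finite_induct)
    case empty
    then show ?case by blast
  next
    case (insert e E)
    define L' where "L' = \<Inter>{P. submodule P R M \<and> L \<union> E \<subseteq> P}"
    have L': "submodule L' R M"
      unfolding L'_def
    proof (rule submodule_Inter)
      have "carrier M \<in> {P. submodule P R M \<and> L \<union> E \<subseteq> P}"
        using carrier_is_submodule submoduleE(1)[OF insert(5)] insert(4) by simp
      then show "{P. submodule P R M \<and> L \<union> E \<subseteq> P} \<noteq> {}" by blast
    qed simp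
    have sub: "L \<subseteq> L'" "E \<subseteq> L'" unfolding L'_def by auto
    obtain E' where E': "finite E'" "generates R M E' L'" using noeth[OF L'] by blast
    have eL': "e \<in> L'"
    proof (rule adjoin_element[OF nil L' E'])
      show "e \<in> carrier M" using insert(4) by simp
      show "\<exists>l\<in>L'. x \<ominus>\<^bsub>M\<^esub> l \<in> Y" if "x \<in> carrier M" "S.nb Y" for x Y
        using dense[OF that] insert(6) sub by blast
      show "carrier M \<subseteq> P" if "submodule P R M" "insert e L' \<subseteq> P" for P
        using insert(7)[OF that(1)] that(2) sub by blast
    qed
    have "carrier M \<subseteq> P" if P: "submodule P R M" "L \<union> E \<subseteq> P" for P
    proof -
      have "L' \<subseteq> P" using P unfolding L'_def by blast
      then show ?thesis using insert(7)[OF P(1)] P(2) eL' by blast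
    qed
    then show ?case using insert.IH insert(4-6) by blast
  qed
  obtain E where E: "finite E" "generates R M E (carrier M)" using noeth[OF carrier_is_submodule] by blast
  have "carrier M \<subseteq> K"
    using E by (intro claim[of E K] K) (auto simp: generates_def)
  then show ?thesis using submoduleE(1)[OF K] by blast
qed

end

section \<open>Closed submodules of a finite free module\<close>

text \<open>A closed submodule \<open>N\<close> of \<open>R^A\<close> with the topology induced by the product topology. It inherits
  completeness from \<open>R\<close> coordinate by coordinate, which makes the open mapping theorem available for it.\<close>

locale closed_function_submodule = filtered_ring R T V for R (structure) and T V +
  fixes A :: "'i set" and N
  assumes A_finite: "finite A"
    and N_submodule: "submodule N R (function_module R A)"
    and N_closed: "\<lbrakk>f \<in> A \<rightarrow>\<^sub>E carrier R; \<And>n. \<exists>g\<in>N. \<forall>a\<in>A. f a \<ominus> g a \<in> V n\<rbrakk> \<Longrightarrow> f \<in> N"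
begin

abbreviation "F \<equiv> function_module R A"
abbreviation "FN \<equiv> F\<lparr>carrier := N\<rparr>"

definition N_ball :: "nat \<Rightarrow> ('i \<Rightarrow> 'a) set" where
  "N_ball n = {f \<in> N. \<forall>a\<in>A. f a \<in> V n}"

sublocale F: module R F by (rule module_function_module)

sublocale FN: module R FN
  by (rule submodule.submodule_is_module[OF N_submodule module_function_module])

lemma N_carrier: "f \<in> N \<Longrightarrow> f \<in> A \<rightarrow>\<^sub>E carrier R"
  using F.submoduleE(1)[OF N_submodule] by auto

lemma N_coord: "f \<in> N \<Longrightarrow> a \<in> A \<Longrightarrow> f a \<in> carrier R"
  using N_carrier[of f] by auto

lemma FN_uminus:
  assumes "f \<in> N"
  shows "\<ominus>\<^bsub>FN\<^esub> f = (\<lambda>a\<in>A. \<ominus> f a)"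
proof (rule FN.M.minus_equality)
  show "f \<in> carrier FN" using assms by simp
  show "(\<lambda>a\<in>A. \<ominus> f a) \<in> carrier FN"
    using F.submoduleE(3)[OF N_submodule assms] function_module_uminus[OF N_carrier[OF assms]] by simp
  show "(\<lambda>a\<in>A. \<ominus> f a) \<oplus>\<^bsub>FN\<^esub> f = \<zero>\<^bsub>FN\<^esub>"
    using N_coord[OF assms] by (auto intro!: ext simp: l_neg)
qed

lemma FN_diff: "f \<in> N \<Longrightarrow> g \<in> N \<Longrightarrow> f \<ominus>\<^bsub>FN\<^esub> g = (\<lambda>a\<in>A. f a \<ominus> g a)"
  by (auto intro!: ext simp: FN.M.minus_eq FN_uminus minus_eq)

text \<open>A subset of \<open>N\<close> is a submodule of \<open>N\<close> if and only if it is one of \<open>R^A\<close>. The operation to compare is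
  negation, whose value in the restricted structure is determined by the smaller carrier.\<close>

lemma FN_submodule_imp:
  assumes "submodule P R FN"
  shows "submodule P R F"
proof -
  have PN: "P \<subseteq> N" using FN.submoduleE(1)[OF assms] by simp
  show ?thesis
  proof (rule F.submoduleI)
    show "P \<subseteq> carrier F" using PN F.submoduleE(1)[OF N_submodule] by blast
    show "\<zero>\<^bsub>F\<^esub> \<in> P" using subgroup.one_closed[OF submodule.axioms(1)[OF assms]] by simp
    show "\<ominus>\<^bsub>F\<^esub> f \<in> P" if "f \<in> P" for f
      using FN.submoduleE(3)[OF assms that] FN_uminus[of f] function_module_uminus[of f A] N_carrier PN that by auto
    show "f \<oplus>\<^bsub>F\<^esub> g \<in> P" if "f \<in> P" "g \<in> P" for f g
      using FN.submoduleE(5)[OF assms that] by simp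
    show "r \<odot>\<^bsub>F\<^esub> f \<in> P" if "r \<in> carrier R" "f \<in> P" for r f
      using FN.submoduleE(4)[OF assms that] by simp
  qed
qed

lemma submodule_imp_FN:
  assumes P: "submodule P R F" and PN: "P \<subseteq> N"
  shows "submodule P R FN"
proof (rule FN.submoduleI)
  show "P \<subseteq> carrier FN" using PN by simp
  show "\<zero>\<^bsub>FN\<^esub> \<in> P" using subgroup.one_closed[OF submodule.axioms(1)[OF P]] by simp
  show "\<ominus>\<^bsub>FN\<^esub> f \<in> P" if "f \<in> P" for f
    using F.submoduleE(3)[OF P that] FN_uminus[of f] function_module_uminus[of f A] N_carrier PN that by auto
  show "f \<oplus>\<^bsub>FN\<^esub> g \<in> P" if "f \<in> P" "g \<in> P" for f g
    using F.submoduleE(5)[OF P that] by simp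
  show "r \<odot>\<^bsub>FN\<^esub> f \<in> P" if "r \<in> carrier R" "f \<in> P" for r f
    using F.submoduleE(4)[OF P that] by simp
qed

lemma N_ball_filtration: "subgroup_filtration FN N_ball"
proof (intro subgroup_filtration.intro subgroup_filtration_axioms.intro)
  show "abelian_group FN" by (rule FN.M.abelian_group_axioms)
  fix n
  show "N_ball (Suc n) \<subseteq> N_ball n" unfolding N_ball_def using V_Suc[of n] by auto
  show "subgroup (N_ball n) (add_monoid FN)"
  proof (rule group.subgroupI[OF FN.M.a_group])
    show "N_ball n \<subseteq> carrier (add_monoid FN)" unfolding N_ball_def by auto
    have "\<zero>\<^bsub>FN\<^esub> \<in> N_ball n" unfolding N_ball_def using FN.M.zero_closed by auto
    then show "N_ball n \<noteq> {}" by blast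
  next
    fix f assume f: "f \<in> N_ball n"
    then have "\<ominus>\<^bsub>FN\<^esub> f \<in> N" using FN.M.a_inv_closed[of f] unfolding N_ball_def by simp
    then show "inv\<^bsub>add_monoid FN\<^esub> f \<in> N_ball n"
      using f FN_uminus[of f] V_uminus unfolding N_ball_def a_inv_def by auto
    fix g assume g: "g \<in> N_ball n"
    then have "f \<oplus>\<^bsub>FN\<^esub> g \<in> N" using f FN.M.a_closed[of f g] unfolding N_ball_def by simp
    then show "f \<otimes>\<^bsub>add_monoid FN\<^esub> g \<in> N_ball n"
      using f g V_add unfolding N_ball_def by auto
  qed
qed

sublocale B: subgroup_filtration FN N_ball by (rule N_ball_filtration)

lemma smult_ballI:
  assumes "r \<in> carrier R" "f \<in> N" "\<And>a. a \<in> A \<Longrightarrow> r \<otimes> f a \<in> V n"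
  shows "r \<odot>\<^bsub>FN\<^esub> f \<in> N_ball n"
  using assms FN.smult_closed[of r f] unfolding N_ball_def by auto

lemma N_topological_module: "topological_module R T FN (subgroup_topology FN N_ball)"
proof (rule topological_module_subgroup_topology[OF FN.module_axioms N_ball_filtration])
  fix r n assume r: "r \<in> carrier R"
  obtain m where m: "\<forall>v\<in>V m. r \<otimes> v \<in> V n" using mult_small_left[OF r] ..
  have "r \<odot>\<^bsub>FN\<^esub> w \<in> N_ball n" if "w \<in> N_ball m" for w
    using that m by (intro smult_ballI r) (auto simp: N_ball_def)
  then show "\<exists>m. \<forall>w\<in>N_ball m. r \<odot>\<^bsub>FN\<^esub> w \<in> N_ball n" by (intro exI ballI)
next
  fix f n assume f: "f \<in> carrier FN"
  then obtain m where m: "\<forall>a\<in>A. \<forall>v\<in>V m. v \<otimes> f a \<in> V n"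
    using mult_small_finite[OF A_finite, of f n] N_coord[of f] by auto
  have "v \<odot>\<^bsub>FN\<^esub> f \<in> N_ball n" if "v \<in> V m" for v
    using that m f V_carrier by (intro smult_ballI) auto
  then show "\<exists>m. \<forall>v\<in>V m. v \<odot>\<^bsub>FN\<^esub> f \<in> N_ball n" by (intro exI ballI)
next
  fix n
  obtain m where m: "\<forall>v\<in>V m. \<forall>w\<in>V m. v \<otimes> w \<in> V n" using mult_small ..
  have "v \<odot>\<^bsub>FN\<^esub> w \<in> N_ball n" if "v \<in> V m" "w \<in> N_ball m" for v w
    using that m V_carrier by (intro smult_ballI) (auto simp: N_ball_def)
  then show "\<exists>m. \<forall>v\<in>V m. \<forall>w\<in>N_ball m. v \<odot>\<^bsub>FN\<^esub> w \<in> N_ball n" by (intro exI ballI)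
qed

lemma N_Hausdorff: "Hausdorff_space (subgroup_topology FN N_ball)"
proof (rule B.Hausdorff_S)
  fix f assume f: "f \<in> carrier FN" "\<And>n. f \<in> N_ball n"
  have "f a = \<zero>" if "a \<in> A" for a
    using f that N_coord[of f a] by (intro V_separates) (auto simp: N_ball_def)
  then show "f = \<zero>\<^bsub>FN\<^esub>"
    using f(1) N_carrier[of f] by (auto intro!: ext simp: PiE_iff extensional_def)
qed

lemma N_complete: "complete_group (add_monoid FN) (subgroup_topology FN N_ball)"
proof (rule B.complete_S)
  fix x assume x: "\<And>i::nat. x i \<in> carrier FN"
    and cauchy: "\<And>n. \<exists>N'. \<forall>m\<ge>N'. \<forall>k\<ge>N'. x m \<ominus>\<^bsub>FN\<^esub> x k \<in> N_ball n"
  have xN: "x i \<in> N" for i using x by simp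
  have near: "x m \<ominus>\<^bsub>FN\<^esub> x k \<in> N_ball n \<longleftrightarrow> (\<forall>a\<in>A. x m a \<ominus> x k a \<in> V n)" for m k n
    using FN.M.minus_closed[OF x[of m] x[of k]] FN_diff[OF xN[of m] xN[of k]] unfolding N_ball_def by auto
  have "\<exists>l\<in>carrier R. \<forall>n. \<exists>N'. \<forall>k\<ge>N'. x k a \<ominus> l \<in> V n" if a: "a \<in> A" for a
  proof -
    have "\<exists>N'. \<forall>k\<ge>N'. x (Suc k) a \<ominus> x k a \<in> V n" for n
    proof -
      obtain N' where "\<forall>m\<ge>N'. \<forall>k\<ge>N'. x m \<ominus>\<^bsub>FN\<^esub> x k \<in> N_ball n" using cauchy[of n] ..
      then show ?thesis using a unfolding near by (intro exI[of _ N']) auto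
    qed
    then have "\<exists>l. limitin T (\<lambda>k. x k a) l sequentially"
      by (intro convergent_of_null_steps) (rule N_coord[OF xN a])
    then obtain l where "limitin T (\<lambda>k. x k a) l sequentially" ..
    then show ?thesis unfolding limitin_iff_V by meson
  qed
  then obtain l where l: "\<And>a. a \<in> A \<Longrightarrow> l a \<in> carrier R"
      "\<And>a n. a \<in> A \<Longrightarrow> \<exists>N'. \<forall>k\<ge>N'. x k a \<ominus> l a \<in> V n"
    by metis
  have conv: "\<exists>N'. \<forall>k\<ge>N'. \<forall>a\<in>A. x k a \<ominus> l a \<in> V n" for n
  proof -
    obtain N' where N': "\<And>a k. a \<in> A \<Longrightarrow> k \<ge> N' a \<Longrightarrow> x k a \<ominus> l a \<in> V n" using l(2)[of _ n] by metis
    have "N' a \<le> (\<Sum>a\<in>A. N' a)" if "a \<in> A" for a using that A_finite by (intro member_le_sum) auto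
    then show ?thesis using N' le_trans by blast
  qed
  define L where "L = restrict l A"
  have LN: "L \<in> N"
  proof (rule N_closed)
    show "L \<in> A \<rightarrow>\<^sub>E carrier R" unfolding L_def using l(1) by auto
    fix n
    obtain k where k: "\<forall>a\<in>A. x k a \<ominus> l a \<in> V n" using conv by blast
    have "L a \<ominus> x k a \<in> V n" if a: "a \<in> A" for a
    proof -
      have "\<ominus> (x k a \<ominus> l a) \<in> V n" using k a V_uminus by simp
      then show ?thesis using l(1)[OF a] N_coord[OF xN a, of k] a unfolding L_def by (simp add: group_simps)
    qed
    then show "\<exists>g\<in>N. \<forall>a\<in>A. L a \<ominus> g a \<in> V n" using xN by blast
  qed
  have "\<exists>N'. \<forall>m\<ge>N'. x m \<ominus>\<^bsub>FN\<^esub> L \<in> N_ball n" for n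
  proof -
    obtain N' where N': "\<forall>k\<ge>N'. \<forall>a\<in>A. x k a \<ominus> l a \<in> V n" using conv by blast
    have "x m \<ominus>\<^bsub>FN\<^esub> L \<in> N_ball n" if "m \<ge> N'" for m
      using FN.M.minus_closed[of "x m" L] xN LN FN_diff[OF xN LN, of m] N' that
      unfolding N_ball_def L_def by auto
    then show ?thesis by blast
  qed
  then show "\<exists>l\<in>carrier FN. \<forall>n. \<exists>N'. \<forall>m\<ge>N'. x m \<ominus>\<^bsub>FN\<^esub> l \<in> N_ball n"
    using LN by (intro bexI[of _ L]) auto
qed

lemma FN_complete_filtered_ring_module:
  assumes "\<And>n. u n \<in> Units R" "limitin T u \<zero> sequentially"
  shows "complete_filtered_ring_module R T V FN (subgroup_topology FN N_ball) u"
proof -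
  have "\<exists>B. countable B \<and> fundamental_system (subgroup_topology FN N_ball) \<zero>\<^bsub>FN\<^esub> B"
    using B.countable_base_S by meson
  then show ?thesis
    using FN.module_axioms filtered_ring_axioms N_topological_module N_Hausdorff N_complete assms
    by (intro complete_filtered_ring_module.intro complete_filtered_ring_module_axioms.intro
        filtered_ring_module.intro filtered_ring_module_axioms.intro)
qed

lemma dense_submodule_eq:
  assumes noeth: "noetherian_ring R"
    and u: "\<And>n. u n \<in> Units R" "limitin T u \<zero> sequentially"
    and nil: "V n \<subseteq> {r \<in> carrier R. topologically_nilpotent R T r}"
    and K: "submodule K R F" "K \<subseteq> N"
    and dense: "\<And>f n. f \<in> N \<Longrightarrow> \<exists>k\<in>K. \<forall>a\<in>A. f a \<ominus> k a \<in> V n"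
  shows "K = N"
proof -
  interpret C: complete_filtered_ring_module R T V FN "subgroup_topology FN N_ball" u
    by (rule FN_complete_filtered_ring_module[OF u])
  have "K = carrier FN"
  proof (rule C.dense_submodule_eq[OF nil])
    fix L assume "submodule L R FN"
    then have "\<exists>E. finite E \<and> generates R F E L"
      by (intro noetherian_function_module[OF noeth is_cring A_finite] FN_submodule_imp)
    then show "\<exists>E. finite E \<and> generates R FN E L"
      unfolding generates_def using FN_submodule_imp by meson
  next
    show "submodule K R FN" by (rule submodule_imp_FN[OF K])
  next
    fix f Y assume f: "f \<in> carrier FN" and Y: "neighbourhood (subgroup_topology FN N_ball) \<zero>\<^bsub>FN\<^esub> Y"
    then obtain n where n: "N_ball n \<subseteq> Y" unfolding B.neighbourhood_S by blast
    obtain k where k: "k \<in> K" "\<forall>a\<in>A. f a \<ominus> k a \<in> V n" using dense[of f n] f by auto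
    have fN: "f \<in> N" and kN: "k \<in> N" using f k K(2) by auto
    have "f \<ominus>\<^bsub>FN\<^esub> k \<in> N_ball n"
      using k FN.M.minus_closed[of f k] fN kN FN_diff[OF fN kN] unfolding N_ball_def by auto
    then show "\<exists>k\<in>K. f \<ominus>\<^bsub>FN\<^esub> k \<in> Y" using n k(1) by blast
  qed
  then show ?thesis by simp
qed

end

section \<open>Closedness of submodules, existence and uniqueness\<close>

text \<open>The closure \<open>N\<close> of \<open>K\<close> is a closed submodule of \<open>R^A\<close> in which \<open>K\<close> is dense, so
  \<open>dense_submodule_eq\<close> applies.\<close>

lemma (in filtered_ring) function_submodule_closed:
  assumes noeth: "noetherian_ring R" and A: "finite A"
    and u: "\<And>n. u n \<in> Units R" "limitin T u \<zero> sequentially"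
    and nil: "V n \<subseteq> {r \<in> carrier R. topologically_nilpotent R T r}"
    and K: "submodule K R (function_module R A)"
    and f: "f \<in> A \<rightarrow>\<^sub>E carrier R" "\<And>n. \<exists>k\<in>K. \<forall>a\<in>A. f a \<ominus> k a \<in> V n"
  shows "f \<in> K"
proof -
  let ?F = "function_module R A"
  interpret F: module R ?F by (rule module_function_module)
  define N where "N = {f \<in> A \<rightarrow>\<^sub>E carrier R. \<forall>n. \<exists>k\<in>K. \<forall>a\<in>A. f a \<ominus> k a \<in> V n}"
  have KF: "k \<in> A \<rightarrow>\<^sub>E carrier R" if "k \<in> K" for k using F.submoduleE(1)[OF K] that by auto
  have NF: "f \<in> A \<rightarrow>\<^sub>E carrier R" if "f \<in> N" for f using that unfolding N_def by simp
  have NK: "\<exists>k\<in>K. \<forall>a\<in>A. f a \<ominus> k a \<in> V n" if "f \<in> N" for f n using that unfolding N_def by simp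
  have KN: "K \<subseteq> N"
  proof
    fix k assume k: "k \<in> K"
    have "k a \<ominus> k a = \<zero>" if "a \<in> A" for a
      using KF[OF k] that by (auto simp: PiE_iff group_simps)
    then have "\<forall>n. \<exists>k'\<in>K. \<forall>a\<in>A. k a \<ominus> k' a \<in> V n" using k by (intro allI bexI[of _ k]) auto
    then show "k \<in> N" using KF[OF k] unfolding N_def by simp
  qed
  have N_sub: "submodule N R ?F"
  proof (rule F.submoduleI)
    show "N \<subseteq> carrier ?F" using NF by auto
    show "\<zero>\<^bsub>?F\<^esub> \<in> N" using subgroup.one_closed[OF submodule.axioms(1)[OF K]] KN by auto
  next
    fix f assume f: "f \<in> N"
    have fa: "f a \<in> carrier R" if "a \<in> A" for a using NF[OF f] that by auto
    have "\<exists>k\<in>K. \<forall>a\<in>A. (\<ominus> f a) \<ominus> k a \<in> V n" for n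
    proof -
      obtain k where k: "k \<in> K" "\<forall>a\<in>A. f a \<ominus> k a \<in> V n" using NK[OF f] by blast
      have "(\<lambda>a\<in>A. \<ominus> k a) \<in> K"
        using F.submoduleE(3)[OF K k(1)] function_module_uminus[OF KF[OF k(1)]] by simp
      moreover have "(\<ominus> f a) \<ominus> (\<ominus> k a) \<in> V n" if a: "a \<in> A" for a
      proof -
        have "\<ominus> (f a \<ominus> k a) \<in> V n" using k(2) a V_uminus by simp
        then show ?thesis using fa[OF a] KF[OF k(1)] a by (simp add: PiE_iff group_simps)
      qed
      ultimately show ?thesis by (intro bexI[of _ "\<lambda>a\<in>A. \<ominus> k a"]) auto
    qed
    then show "\<ominus>\<^bsub>?F\<^esub> f \<in> N"
      unfolding function_module_uminus[OF NF[OF f]] using fa unfolding N_def by auto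
    fix r assume r: "r \<in> carrier R"
    have "\<exists>k\<in>K. \<forall>a\<in>A. r \<otimes> f a \<ominus> k a \<in> V n" for n
    proof -
      obtain m where m: "\<forall>v\<in>V m. r \<otimes> v \<in> V n" using mult_small_left[OF r] ..
      obtain k where k: "k \<in> K" "\<forall>a\<in>A. f a \<ominus> k a \<in> V m" using NK[OF f] by blast
      have "(\<lambda>a\<in>A. r \<otimes> k a) \<in> K" using F.submoduleE(4)[OF K r k(1)] by simp
      moreover have "r \<otimes> f a \<ominus> r \<otimes> k a \<in> V n" if a: "a \<in> A" for a
      proof -
        have "r \<otimes> (f a \<ominus> k a) \<in> V n" using k(2) m a by simp
        then show ?thesis using r fa[OF a] KF[OF k(1)] a by (simp add: PiE_iff minus_eq r_distr r_minus)
      qed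
      ultimately show ?thesis by (intro bexI[of _ "\<lambda>a\<in>A. r \<otimes> k a"]) auto
    qed
    then show "r \<odot>\<^bsub>?F\<^esub> f \<in> N" using fa r unfolding N_def by auto
  next
    fix f g assume f: "f \<in> N" and g: "g \<in> N"
    have fa: "f a \<in> carrier R" "g a \<in> carrier R" if "a \<in> A" for a using NF[OF f] NF[OF g] that by auto
    have "\<exists>k\<in>K. \<forall>a\<in>A. (f a \<oplus> g a) \<ominus> k a \<in> V n" for n
    proof -
      obtain k where k: "k \<in> K" "\<forall>a\<in>A. f a \<ominus> k a \<in> V n" using NK[OF f] by blast
      obtain h where h: "h \<in> K" "\<forall>a\<in>A. g a \<ominus> h a \<in> V n" using NK[OF g] by blast
      have "(\<lambda>a\<in>A. k a \<oplus> h a) \<in> K" using F.submoduleE(5)[OF K k(1) h(1)] by simp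
      moreover have "(f a \<oplus> g a) \<ominus> (k a \<oplus> h a) \<in> V n" if a: "a \<in> A" for a
      proof -
        have "(f a \<ominus> k a) \<oplus> (g a \<ominus> h a) \<in> V n" using k(2) h(2) a V_add by simp
        then show ?thesis using fa[OF a] KF[OF k(1)] KF[OF h(1)] a by (simp add: PiE_iff group_simps)
      qed
      ultimately show ?thesis by (intro bexI[of _ "\<lambda>a\<in>A. k a \<oplus> h a"]) auto
    qed
    then show "f \<oplus>\<^bsub>?F\<^esub> g \<in> N" using fa unfolding N_def by auto
  qed
  have closed: "f \<in> N" if f: "f \<in> A \<rightarrow>\<^sub>E carrier R" and g: "\<And>n. \<exists>g\<in>N. \<forall>a\<in>A. f a \<ominus> g a \<in> V n" for f
  proof -
    have "\<exists>k\<in>K. \<forall>a\<in>A. f a \<ominus> k a \<in> V n" for n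
    proof -
      obtain g where g: "g \<in> N" "\<forall>a\<in>A. f a \<ominus> g a \<in> V n" using g by blast
      obtain k where k: "k \<in> K" "\<forall>a\<in>A. g a \<ominus> k a \<in> V n" using NK[OF g(1)] by blast
      have "f a \<ominus> k a \<in> V n" if a: "a \<in> A" for a
      proof -
        have "(f a \<ominus> g a) \<oplus> (g a \<ominus> k a) \<in> V n" using k(2) g(2) a V_add by simp
        then show ?thesis using f NF[OF g(1)] KF[OF k(1)] a by (simp add: PiE_iff group_simps)
      qed
      then show ?thesis using k(1) by blast
    qed
    then show ?thesis using f unfolding N_def by simp
  qed
  interpret N: closed_function_submodule R T V A N
    by (intro closed_function_submodule.intro closed_function_submodule_axioms.intro
        filtered_ring_axioms A N_sub closed)
  have KeqN: "K = N" by (rule N.dense_submodule_eq[OF noeth u nil K KN NK])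
  have "f \<in> N" using f unfolding N_def by simp
  then show ?thesis by (simp only: KeqN)
qed

context finitely_generated_filtered_module begin

lemma lincomb_restrict:
  assumes "c \<in> E \<rightarrow> carrier R"
  shows "lincomb M E (restrict c E) = lincomb M E c"
  unfolding lincomb_def using assms E_carrier by (intro M.finsum_cong') auto

text \<open>The kernel of \<open>R^E \<rightarrow> M\<close>.\<close>

lemma relations_submodule:
  "submodule {f \<in> E \<rightarrow>\<^sub>E carrier R. lincomb M E f = \<zero>\<^bsub>M\<^esub>} R (function_module R E)" (is "submodule ?K R ?F")
proof -
  interpret F: module R ?F by (rule module_function_module)
  have PiE: "f \<in> E \<rightarrow> carrier R" if "f \<in> E \<rightarrow>\<^sub>E carrier R" for f using that by auto
  show ?thesis
  proof (rule F.submoduleI)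
    show "?K \<subseteq> carrier ?F" by auto
    show "\<zero>\<^bsub>?F\<^esub> \<in> ?K"
      using lincomb_restrict[of "\<lambda>_. \<zero>"] lincomb_zero[OF E_carrier] by auto
  next
    fix f assume f: "f \<in> ?K"
    then have fE: "f \<in> E \<rightarrow>\<^sub>E carrier R" "f \<in> E \<rightarrow> carrier R" and z: "lincomb M E f = \<zero>\<^bsub>M\<^esub>" by auto
    have "lincomb M E (\<lambda>e\<in>E. \<ominus> f e) = \<zero>\<^bsub>M\<^esub>"
      using lincomb_restrict[of "\<lambda>e. \<ominus> f e"] lincomb_uminus[OF E_carrier E_finite fE(2)] fE z
      by (simp add: Pi_iff M.uminus_zero)
    then show "\<ominus>\<^bsub>?F\<^esub> f \<in> ?K" unfolding function_module_uminus[OF fE(1)] using fE by auto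
    fix r assume r: "r \<in> carrier R"
    have "lincomb M E (\<lambda>e\<in>E. r \<otimes> f e) = \<zero>\<^bsub>M\<^esub>"
      using lincomb_restrict[of "\<lambda>e. r \<otimes> f e"] lincomb_smult[OF E_carrier E_finite fE(2) r] fE z r
      by (simp add: Pi_iff)
    then show "r \<odot>\<^bsub>?F\<^esub> f \<in> ?K" using fE r by auto
  next
    fix f g assume "f \<in> ?K" "g \<in> ?K"
    then have fE: "f \<in> E \<rightarrow> carrier R" "g \<in> E \<rightarrow> carrier R"
      and z: "lincomb M E f = \<zero>\<^bsub>M\<^esub>" "lincomb M E g = \<zero>\<^bsub>M\<^esub>" by auto
    have "lincomb M E (\<lambda>e\<in>E. f e \<oplus> g e) = \<zero>\<^bsub>M\<^esub>"
      using lincomb_restrict[of "\<lambda>e. f e \<oplus> g e"] lincomb_add[OF E_carrier fE] fE z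
      by (simp add: Pi_iff)
    then show "f \<oplus>\<^bsub>?F\<^esub> g \<in> ?K" using fE by auto
  qed
qed

text \<open>If \<open>x\<close> is the image of \<open>c\<close> and lies in every \<open>W n\<close>, then \<open>c\<close> lies in the closure of the kernel of
  \<open>R^E \<rightarrow> M\<close>. The kernel is closed, so \<open>x = 0\<close>.\<close>

lemma W_Hausdorff:
  assumes noeth: "noetherian_ring R"
    and u: "\<And>n. u n \<in> Units R" "limitin T u \<zero> sequentially"
    and nil: "V n \<subseteq> {r \<in> carrier R. topologically_nilpotent R T r}"
  shows "Hausdorff_space (subgroup_topology M W)"
proof (rule W.Hausdorff_S)
  fix x assume x: "x \<in> carrier M" "\<And>n. x \<in> W n"
  let ?K = "{f \<in> E \<rightarrow>\<^sub>E carrier R. lincomb M E f = \<zero>\<^bsub>M\<^esub>}"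
  obtain c where c: "c \<in> E \<rightarrow> carrier R" "x = lincomb M E c"
    using x(1) unfolding gen[symmetric] by (rule in_lincombsE)
  have "restrict c E \<in> ?K"
  proof (rule function_submodule_closed[OF noeth E_finite u nil relations_submodule])
    show "restrict c E \<in> E \<rightarrow>\<^sub>E carrier R" using c(1) by auto
    fix n
    obtain d where d: "d \<in> E \<rightarrow> V n" "x = lincomb M E d" using x(2)[of n] by (rule in_lincombsE)
    have dR: "d \<in> E \<rightarrow> carrier R" by (rule V_coeffs[OF d(1)])
    let ?k = "\<lambda>e\<in>E. c e \<ominus> d e"
    have "lincomb M E ?k = lincomb M E c \<ominus>\<^bsub>M\<^esub> lincomb M E d"
      using lincomb_restrict[of "\<lambda>e. c e \<ominus> d e"] lincomb_diff[OF E_carrier E_finite c(1) dR] c(1) dR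
      by (simp add: Pi_iff)
    also have "\<dots> = \<zero>\<^bsub>M\<^esub>" using x(1) c(2) d(2) by (simp add: M.group_simps)
    finally have "?k \<in> ?K" using c(1) dR by auto
    moreover have "restrict c E e \<ominus> ?k e \<in> V n" if e: "e \<in> E" for e
    proof -
      have "c e \<in> carrier R" "d e \<in> carrier R" "d e \<in> V n" using e c(1) dR d(1) by auto
      then show ?thesis using e by (simp add: R.group_simps)
    qed
    ultimately show "\<exists>k\<in>?K. \<forall>e\<in>E. restrict c E e \<ominus> k e \<in> V n" by (intro bexI[of _ ?k]) auto
  qed
  then show "x = \<zero>\<^bsub>M\<^esub>" using lincomb_restrict[OF c(1)] c(2) by simp
qed

end

lemma filtered_ring_exists:
  fixes R (structure)
  assumes "zero_sequence_ring R T"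
  shows "\<exists>V. filtered_ring R T V"
proof -
  have top: "topological_ring R T" and haus: "Hausdorff_space T"
    and comp: "complete_group (add_monoid R) T"
    using assms unfolding zero_sequence_ring_def by auto
  obtain B where B: "countable B" "fundamental_system T \<zero> B"
    using assms unfolding zero_sequence_ring_def by auto
  obtain H where H: "fundamental_system T \<zero> H" "\<forall>W\<in>H. subgroup W (add_monoid R)"
    using assms unfolding zero_sequence_ring_def non_archimedean_def by auto
  interpret cring R using top unfolding topological_ring_def by simp
  interpret topological_abelian_group R T
    by unfold_locales (use top in \<open>simp add: topological_ring_def\<close>)
  have HB: "\<exists>W\<in>H. W \<subseteq> Y" if "nb Y" for Y using H(1) that unfolding fundamental_system_def by simp
  have Hnb: "nb W" if "W \<in> H" for W using H(1) that unfolding fundamental_system_def by simp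
  have Bnb: "nb W" if "W \<in> B" for W using B(2) that unfolding fundamental_system_def by simp
  have BB: "\<exists>W\<in>B. W \<subseteq> Y" if "nb Y" for Y using B(2) that unfolding fundamental_system_def by simp
  have "nb (carrier R)" using openin_imp_neighbourhood[OF openin_topspace, of \<zero> T] by simp
  then have ne: "B \<noteq> {}" using BB by blast
  let ?b = "from_nat_into B"
  have b: "nb (?b n)" for n using Bnb from_nat_into[OF ne] by simp
  have "\<exists>V. \<forall>n. (V n \<in> H \<and> V n \<subseteq> ?b n) \<and> V (Suc n) \<subseteq> V n"
  proof (rule dependent_nat_choice[where P = "\<lambda>n W. W \<in> H \<and> W \<subseteq> ?b n" and Q = "\<lambda>n W W'. W' \<subseteq> W"])
    show "\<exists>W. W \<in> H \<and> W \<subseteq> ?b 0" using HB[OF b] by blast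
    fix W n assume W: "W \<in> H \<and> W \<subseteq> ?b n"
    have "nb (W \<inter> ?b (Suc n))" using W by (intro neighbourhood_Int Hnb b) simp
    then show "\<exists>W'. (W' \<in> H \<and> W' \<subseteq> ?b (Suc n)) \<and> W' \<subseteq> W" using HB by blast
  qed
  then obtain V where "\<forall>n. (V n \<in> H \<and> V n \<subseteq> ?b n) \<and> V (Suc n) \<subseteq> V n" ..
  then have V: "V n \<in> H" "V n \<subseteq> ?b n" "V (Suc n) \<subseteq> V n" for n by simp_all
  have base: "\<exists>n. V n \<subseteq> Y" if Y: "nb Y" for Y
  proof -
    obtain W where W: "W \<in> B" "W \<subseteq> Y" using BB[OF Y] by blast
    obtain n where n: "?b n = W" using from_nat_into_surj[OF B(1) W(1)] by blast
    show ?thesis using V(2)[of n] n W(2) by (intro exI[of _ n]) simp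
  qed
  have sub: "subgroup (V n) (add_monoid R)" for n using H(2) V(1) by simp
  have "filtered_ring R T V"
    by (intro filtered_ring.intro filtered_ring_axioms.intro is_cring top haus comp
        sub Hnb[OF V(1)] V(3) base)
  then show ?thesis by (rule exI[of _ V])
qed

lemma existence_and_uniqueness:
  fixes R (structure) and M (structure)
  assumes R: "zero_sequence_ring R T" and M: "finitely_generated_module R M"
  shows "\<exists>!S. topological_module R T M S \<and> Hausdorff_space S \<and>
      (\<exists>B. countable B \<and> (\<forall>U\<in>B. openin S U) \<and> fundamental_system S \<zero>\<^bsub>M\<^esub> B) \<and>
      complete_group (add_monoid M) S"
proof -
  obtain V where "filtered_ring R T V" using filtered_ring_exists[OF R] ..
  then interpret filtered_ring R T V .
  interpret M: module R M using M unfolding finitely_generated_module_def by simp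
  obtain E where E: "finite E" "E \<subseteq> carrier M"
      and span: "\<forall>x\<in>carrier M. \<exists>c\<in>E \<rightarrow> carrier R. x = (\<Oplus>\<^bsub>M\<^esub>a\<in>E. c a \<odot>\<^bsub>M\<^esub> a)"
    using M unfolding finitely_generated_module_def by blast
  have "lincombs M E (carrier R) = carrier M"
  proof
    show "lincombs M E (carrier R) \<subseteq> carrier M" by (rule M.lincombs_carrier[OF E(2)]) simp
    show "carrier M \<subseteq> lincombs M E (carrier R)"
      using span unfolding lincombs_def lincomb_def by blast
  qed
  with E interpret finitely_generated_filtered_module R T V M E
    by unfold_locales
  obtain u where u: "\<And>n. u n \<in> Units R" "limitin T u \<zero>\<^bsub>R\<^esub> sequentially"
    using R unfolding zero_sequence_ring_def by blast
  have noeth: "noetherian_ring R" and "nb {r \<in> carrier R. topologically_nilpotent R T r}"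
    using R unfolding zero_sequence_ring_def by simp_all
  then obtain n where n: "V n \<subseteq> {r \<in> carrier R. topologically_nilpotent R T r}" using V_base by blast
  show ?thesis
  proof (rule ex1I[of _ "subgroup_topology M W"])
    show "topological_module R T M (subgroup_topology M W) \<and> Hausdorff_space (subgroup_topology M W) \<and>
      (\<exists>B. countable B \<and> (\<forall>U\<in>B. openin (subgroup_topology M W) U) \<and>
        fundamental_system (subgroup_topology M W) \<zero>\<^bsub>M\<^esub> B) \<and>
      complete_group (add_monoid M) (subgroup_topology M W)"
      using W_topological_module W_Hausdorff[OF noeth u n] W.countable_base_S W_complete by simp
  next
    fix S
    assume S: "topological_module R T M S \<and> Hausdorff_space S \<and>
      (\<exists>B. countable B \<and> (\<forall>U\<in>B. openin S U) \<and> fundamental_system S \<zero>\<^bsub>M\<^esub> B) \<and>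
      complete_group (add_monoid M) S"
    then have "\<exists>B. countable B \<and> fundamental_system S \<zero>\<^bsub>M\<^esub> B" by meson
    then have "complete_filtered_ring_module R T V M S u"
      using S u M.module_axioms filtered_ring_axioms
      by (intro complete_filtered_ring_module.intro complete_filtered_ring_module_axioms.intro
          filtered_ring_module.intro filtered_ring_module_axioms.intro) simp_all
    then show "S = subgroup_topology M W" by (rule eq_W_topology)
  qed
qed

section \<open>Tate rings\<close>

lemma neighbourhood_open_subtopology:
  assumes "openin T A"
  shows "neighbourhood (subtopology T A) x P \<longleftrightarrow> neighbourhood T x P \<and> P \<subseteq> A"
  unfolding neighbourhood_def openin_open_subtopology[OF assms]
  using openin_subset[OF assms] by (simp add: topspace_subtopology) (meson order_trans)

lemma fundamental_system_of_open_subtopology: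
  assumes A: "openin T A" "x \<in> A" and B: "fundamental_system (subtopology T A) x B"
  shows "fundamental_system T x B"
  unfolding fundamental_system_def
proof (intro conjI ballI allI impI)
  show "neighbourhood T x P" if "P \<in> B" for P
    using B that neighbourhood_open_subtopology[OF A(1)] unfolding fundamental_system_def by blast
  fix Y assume "neighbourhood T x Y"
  then have "neighbourhood T x (Y \<inter> A)" by (rule neighbourhood_Int[OF _ openin_imp_neighbourhood[OF A]])
  then have "neighbourhood (subtopology T A) x (Y \<inter> A)" using neighbourhood_open_subtopology[OF A(1)] by blast
  then show "\<exists>P\<in>B. P \<subseteq> Y" using B unfolding fundamental_system_def by blast
qed

text \<open>The powers of the ideal are additive subgroups of \<open>R\<close> and form a base at zero also in \<open>R\<close>, because
  \<open>R0\<close> is open. If \<open>r\<close> is in \<open>I\<close> then \<open>r^n\<close> is in the \<open>n\<close>-th power of \<open>I\<close>, so \<open>r\<close> is topologically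
  nilpotent.\<close>

lemma Tate_ring_imp_zero_sequence_ring:
  fixes R (structure)
  assumes Tate: "Tate_ring R T" and noeth: "noetherian_ring R" and haus: "Hausdorff_space T"
    and comp: "complete_group (add_monoid R) T"
  shows "zero_sequence_ring R T"
proof -
  have top: "topological_ring R T" using Tate unfolding Tate_ring_def by simp
  interpret cring R using top unfolding topological_ring_def by simp
  interpret topological_abelian_group R T
    by unfold_locales (use top in \<open>simp add: topological_ring_def\<close>)
  obtain u where u: "u \<in> Units R" "topologically_nilpotent R T u"
    using Tate unfolding Tate_ring_def by blast
  obtain R0 I A where R0: "subring R0 R" "openin T R0" and A: "A \<subseteq> R0"
    and I: "I = Idl\<^bsub>R\<lparr>carrier := R0\<rparr>\<^esub> A"
    and fund: "fundamental_system (subtopology T R0) \<zero> (range (ideal_power (R\<lparr>carrier := R0\<rparr>) I))"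
    using Tate unfolding Tate_ring_def by auto
  let ?Q = "R\<lparr>carrier := R0\<rparr>"
  let ?P = "ideal_power ?Q I"
  interpret Q: ring ?Q by (rule subring_is_ring[OF R0(1)])
  have idI: "ideal I ?Q" unfolding I using A by (intro Q.genideal_ideal) simp
  have idP: "ideal (?P n) ?Q" for n
    by (induction n) (simp_all only: ideal_power.simps Q.oneideal Q.ideal_prod_is_ideal[OF _ idI])
  have P_Suc: "?P (Suc n) \<subseteq> ?P n" and P_I: "?P (Suc n) \<subseteq> I" for n
    using Q.ideal_prod_inter[OF idP idI] by auto
  have P_anti: "?P n \<subseteq> ?P m" if "m \<le> n" for m n
    using lift_Suc_antimono_le[of ?P m n] P_Suc that by simp
  have P_carrier: "p \<in> carrier R" if "p \<in> ?P n" for p n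
    using additive_subgroup.a_subset[OF ideal.axioms(1)[OF idP]] subringE(1)[OF R0(1)] that by auto
  have fundR: "fundamental_system T \<zero> (range ?P)"
    by (rule fundamental_system_of_open_subtopology[OF R0(2) subringE(2)[OF R0(1)] fund])
  then have P_nb: "nb (?P n)" and P_base: "nb Y \<Longrightarrow> \<exists>n. ?P n \<subseteq> Y" for n Y
    unfolding fundamental_system_def by auto
  have P_subgroup: "subgroup (?P n) (add_monoid R)" for n
  proof (rule group.subgroupI[OF a_group])
    show "?P n \<subseteq> carrier (add_monoid R)" using P_carrier by auto
    show "?P n \<noteq> {}" using neighbourhood_self[OF P_nb] by blast
  next
    have sg: "subgroup (?P n) (add_monoid ?Q)" by (rule additive_subgroup.a_subgroup[OF ideal.axioms(1)[OF idP]])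
    fix a assume a: "a \<in> ?P n"
    have "\<ominus>\<^bsub>?Q\<^esub> a \<in> ?P n" using subgroup.m_inv_closed[OF sg a] by (simp add: a_inv_def)
    moreover have "\<ominus>\<^bsub>?Q\<^esub> a \<oplus> a = \<zero>"
      using Q.l_neg[of a] additive_subgroup.a_subset[OF ideal.axioms(1)[OF idP]] a by auto
    ultimately show "inv\<^bsub>add_monoid R\<^esub> a \<in> ?P n"
      using minus_equality[of "\<ominus>\<^bsub>?Q\<^esub> a" a] P_carrier a by (simp add: a_inv_def)
    fix b assume "b \<in> ?P n"
    then show "a \<otimes>\<^bsub>add_monoid R\<^esub> b \<in> ?P n" using subgroup.m_closed[OF sg a] by simp
  qed
  have nilpotent: "topologically_nilpotent R T r" if r: "r \<in> I" for r
  proof -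
    have rR: "r \<in> carrier R"
      using r additive_subgroup.a_subset[OF ideal.axioms(1)[OF idI]] subringE(1)[OF R0(1)] by auto
    have pow: "r [^] n \<in> ?P n" for n :: nat
    proof (induction n)
      case 0
      show ?case using subringE(3)[OF R0(1)] by simp
    next
      case (Suc n)
      show ?case using ideal_prod.prod[of "r [^] n" "?P n" r I ?Q] Suc r by simp
    qed
    have "\<exists>N. \<forall>n::nat\<ge>N. r [^] n \<in> carrier R \<and> r [^] n \<ominus> \<zero> \<in> Y" if Y: "nb Y" for Y
    proof -
      obtain N where N: "?P N \<subseteq> Y" using P_base[OF Y] ..
      have "r [^] n \<in> Y" if "n \<ge> N" for n :: nat using P_anti[OF that] pow[of n] N by auto
      then have "\<forall>n::nat\<ge>N. r [^] n \<in> carrier R \<and> r [^] n \<ominus> \<zero> \<in> Y"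
        using rR by (simp add: minus_eq)
      then show ?thesis by (rule exI)
    qed
    then show ?thesis unfolding topologically_nilpotent_def limitin_iff_nb using rR by simp
  qed
  have "?P 1 \<subseteq> {r \<in> carrier R. topologically_nilpotent R T r}"
    using P_I[of 0] nilpotent P_carrier[of _ 1] by auto
  then have nilp_nb: "nb {r \<in> carrier R. topologically_nilpotent R T r}"
    by (rule neighbourhood_mono[OF P_nb]) auto
  have "\<exists>v. (\<forall>n. v n \<in> Units R) \<and> limitin T v \<zero> sequentially"
    using u by (intro exI[of _ "\<lambda>n::nat. u [^] n"]) (auto simp: topologically_nilpotent_def Units_pow_closed)
  moreover have "non_archimedean R T"
    unfolding non_archimedean_def using fundR P_subgroup by (intro exI[of _ "range ?P"]) auto
  moreover have "\<exists>B. countable B \<and> fundamental_system T \<zero> B"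
    using fundR by (intro exI[of _ "range ?P"]) simp
  ultimately show ?thesis
    unfolding zero_sequence_ring_def using top noeth haus comp nilp_nb by simp
qed

theorem theorem0p3:
  fixes R :: "('a, 'm) ring_scheme" and T :: "'a topology"
    and M :: "('a, 'b, 'n) module_scheme"
  shows "(zero_sequence_ring R T \<and> module R M \<and> finitely_generated_module R M \<longrightarrow>
           (\<exists>!S. topological_module R T M S \<and>
                 Hausdorff_space S \<and>
                 (\<exists>B. countable B \<and> (\<forall>U\<in>B. openin S U) \<and> fundamental_system S \<zero>\<^bsub>M\<^esub> B) \<and>
                 complete_group (add_monoid M) S)) \<and>
         (Tate_ring R T \<and> noetherian_ring R \<and> Hausdorff_space T \<and>
            complete_group (add_monoid R) T \<longrightarrow>
          zero_sequence_ring R T)"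
  using existence_and_uniqueness[of R T M] Tate_ring_imp_zero_sequence_ring[of R T] by blast

end
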